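(* For any integer $d\ge 4$, there exists a polynomial $Q_d(X,Y)\in\mathbb{R}[X,Y]$ of degree $d$ such that the real curve with equation $\mathrm{Hess}(Q_d)(X,Y)=0$ is smooth and has $(d-2)^2$ compact connected components in $\mathbb{R}^2$.
   Context: For a polynomial $Q(X,Y)$ in two variables (not necessarily homogeneous), its Hessian is the polynomial $$\mathrm{Hess}(Q)=\frac{\partial^2 Q}{\partial X^2}\frac{\partial^2 Q}{\partial Y^2}-\left(\frac{\partial^2 Q}{\partial X\,\partial Y}\right)^2 .$$ *)

theory Defs
  imports "HOL-Analysis.Analysis" "HOL-Computational_Algebra.Polynomial"
begin

(* A polynomial Q in R[X,Y] is represented in R[X][Y] as a value of type real poly poly:
   the outer variable is Y, the inner one is X, and
   coeff (coeff Q j) i is the coefficient of X^i Y^j. *)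

definition eval2 :: "real poly poly \<Rightarrow> real \<Rightarrow> real \<Rightarrow> real" where
  "eval2 Q x y = poly (poly Q [:y:]) x"

(* Total degree in X and Y jointly; the zero polynomial gets total degree 0. *)
definition total_deg :: "real poly poly \<Rightarrow> nat" where
  "total_deg Q = Max (insert 0 {i + j | i j. coeff (coeff Q j) i \<noteq> 0})"

lemma finite_support2: "finite {i + j | i j. coeff (coeff (Q :: real poly poly) j) i \<noteq> 0}"
proof (rule finite_subset)
  show "{i + j | i j. coeff (coeff Q j) i \<noteq> 0}
    \<subseteq> (\<Union>j\<in>{..degree Q}. (\<lambda>i. i + j) ` {..degree (coeff Q j)})"
  proof clarify
    fix i j assume a: "coeff (coeff Q j) i \<noteq> 0"
    then have "coeff Q j \<noteq> 0" by auto
    then show "i + j \<in> (\<Union>j\<in>{..degree Q}. (\<lambda>i. i + j) ` {..degree (coeff Q j)})"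
      using le_degree[OF a] le_degree[OF \<open>coeff Q j \<noteq> 0\<close>] by (intro UN_I[of j]) auto
  qed
qed simp

definition partial_X :: "real poly poly \<Rightarrow> real poly poly" where
  "partial_X Q = map_poly pderiv Q"

definition partial_Y :: "real poly poly \<Rightarrow> real poly poly" where
  "partial_Y Q = pderiv Q"

lemma coeff_partial_X:
  "coeff (coeff (partial_X Q) j) i = of_nat (Suc i) * coeff (coeff Q j) (Suc i)"
  by (simp add: partial_X_def coeff_map_poly coeff_pderiv)

lemma coeff_partial_Y:
  "coeff (coeff (partial_Y Q) j) i = of_nat (Suc j) * coeff (coeff Q (Suc j)) i"
  by (simp only: partial_Y_def coeff_pderiv of_nat_poly coeff_smult mult_pCons_left) simp

definition Hess :: "real poly poly \<Rightarrow> real poly poly" where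
  "Hess Q = partial_X (partial_X Q) * partial_Y (partial_Y Q) - (partial_X (partial_Y Q))\<^sup>2"

definition real_curve :: "real poly poly \<Rightarrow> (real \<times> real) set" where
  "real_curve P = {(x, y). eval2 P x y = 0}"

(* Smoothness of the real curve with equation P = 0: no real point of the curve is singular,
   i.e. the gradient of the defining equation P vanishes nowhere on it.  This depends on P and
   not only on the point set (a squared equation is never smooth unless it has no real zero). *)
definition smooth_real_curve :: "real poly poly \<Rightarrow> bool" where
  "smooth_real_curve P \<longleftrightarrow>
     (\<forall>(x, y) \<in> real_curve P. eval2 (partial_X P) x y \<noteq> 0 \<or> eval2 (partial_Y P) x y \<noteq> 0)"

end

theory Submission
  imports Defs
begin

text \<open>
  The construction is a patchworking over the honeycomb triangulation of the triangle
  \<open>{(i, j). i + j \<le> k}\<close>, \<open>k = d - 2\<close>, which has \<open>k\<^sup>2\<close> unimodular triangles. Put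
  \<open>Q = \<Sum> (-1)^(i + j) t^ht(i, j) X^(i + 1) Y^(j + 1)\<close> with the convex height
  \<open>ht(i, j) = 3i\<^sup>2 + 2ij + 3j\<^sup>2\<close> and \<open>t > 0\<close> small. At every point of the plane all terms but those
  of one triangle are negligible, so the Hessian is close to that of a trinomial.
  For an upward triangle the Hessian of the trinomial is, up to a monomial factor, a concave quadratic
  polynomial that is positive exactly inside an ellipse; this gives one oval. For a downward triangle
  this quadratic polynomial degenerates: its maximum is \<open>0\<close>. At the maximum the second derivatives
  of all three terms cancel, and the fourth vertex of the parallelogram contributes in the next order
  \<open>t\<^sup>2\<close>; after rescaling by \<open>t\<^sup>2\<close> the same ellipse as for the adjacent upward triangle appears.
  The Hessian is negative everywhere else, so that there are exactly \<open>k\<^sup>2\<close> components, all compact.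
\<close>

text \<open>The factor XY makes the Hessian a quadratic form in the values of the monomials with i +
  j \<le> k. All estimates can then be relative to the largest of these values, so they are uniform
  over the plane, axes and unbounded parts included. In the form of an upward triangle only the
  square of the value at the corner (i, j) has a positive coefficient. A downward triangle has no
  term there: its weights are linearly dependent, one vertex can be eliminated onto the other two,
  and the rest is negative definite in those two values. The fourth vertex must supply the positive
  square, and this decides the height: above the affine function through a triangle, the excess is 2
  at the vertex opposite the side from (i + 1, j) to (i, j + 1), and at least 4 at all other lattice
  points off the triangle. Division by t^2 thus isolates the fourth vertex. The alternating signs
  give the ellipses centres with positive coordinates. Since the count is exact, two global facts
  accompany the ovals: a nonnegative Hessian puts the point into some slightly enlarged ellipse, and
  the sizes of the terms tell which one.\<close>

section \<open>Evaluation and differentiation of bivariate polynomials\<close>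

lemma eval2_0 [simp]: "eval2 0 x y = 0"
  and eval2_add: "eval2 (P + Q) x y = eval2 P x y + eval2 Q x y"
  and eval2_diff: "eval2 (P - Q) x y = eval2 P x y - eval2 Q x y"
  and eval2_mult: "eval2 (P * Q) x y = eval2 P x y * eval2 Q x y"
  and eval2_power: "eval2 (P ^ n) x y = eval2 P x y ^ n"
  and eval2_pCons: "eval2 (pCons p P) x y = poly p x + y * eval2 P x y"
  by (simp_all add: eval2_def)

lemma eval2_sum: "eval2 (sum f A) x y = (\<Sum>a\<in>A. eval2 (f a) x y)"
  by (induction A rule: infinite_finite_induct) (simp_all add: eval2_add)

lemma eval2_monom: "eval2 (monom (monom c i) j) x y = c * x ^ i * y ^ j"
  by (simp add: eval2_def poly_monom)

lemma partial_X_0 [simp]: "partial_X 0 = 0"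
  and partial_X_pCons: "partial_X (pCons p P) = pCons (pderiv p) (partial_X P)"
  and partial_X_add: "partial_X (P + Q) = partial_X P + partial_X Q"
  and partial_X_monom: "partial_X (monom (monom c i) j) = monom (monom (of_nat i * c) (i - 1)) j"
proof -
  show "partial_X 0 = 0"
    by (simp add: partial_X_def)
  show "partial_X (pCons p P) = pCons (pderiv p) (partial_X P)"
    by (rule poly_eqI, rule poly_eqI)
       (simp add: coeff_partial_X coeff_pCons coeff_pderiv split: nat.splits)
  show "partial_X (P + Q) = partial_X P + partial_X Q"
    by (rule poly_eqI, rule poly_eqI) (simp add: coeff_partial_X algebra_simps)
  show "partial_X (monom (monom c i) j) = monom (monom (of_nat i * c) (i - 1)) j"
    by (rule poly_eqI, rule poly_eqI) (auto simp add: coeff_partial_X)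
qed

lemma partial_Y_0 [simp]: "partial_Y 0 = 0"
  and partial_Y_pCons: "partial_Y (pCons p P) = P + pCons 0 (partial_Y P)"
  and partial_Y_add: "partial_Y (P + Q) = partial_Y P + partial_Y Q"
  by (simp_all add: partial_Y_def pderiv_pCons pderiv_add)

lemma partial_Y_monom: "partial_Y (monom (monom c i) j) = monom (monom (of_nat j * c) i) (j - 1)"
  by (rule poly_eqI, rule poly_eqI) (auto simp add: coeff_partial_Y)

lemma partial_X_sum: "partial_X (sum f A) = (\<Sum>a\<in>A. partial_X (f a))"
  and partial_Y_sum: "partial_Y (sum f A) = (\<Sum>a\<in>A. partial_Y (f a))"
  by (induction A rule: infinite_finite_induct) (simp_all add: partial_X_add partial_Y_add)

lemma has_derivative_eval2:
  "((\<lambda>z. eval2 P (fst z) (snd z)) has_derivative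
     (\<lambda>h. fst h * eval2 (partial_X P) (fst z) (snd z) + snd h * eval2 (partial_Y P) (fst z) (snd z)))
   (at z)"
proof (induction P)
  case 0
  then show ?case by simp
next
  case (pCons p P)
  have d: "((\<lambda>z. poly p (fst z)) has_derivative (\<lambda>h. fst h * poly (pderiv p) (fst z))) (at z)"
  proof -
    have "(poly p has_derivative (\<lambda>h. h * poly (pderiv p) (fst z))) (at (fst z))"
      using poly_DERIV[of p "fst z"] unfolding has_field_derivative_def
      by (rule has_derivative_eq_rhs) (auto simp: fun_eq_iff)
    then show ?thesis
      using has_derivative_compose[OF has_derivative_fst[OF has_derivative_ident]] by blast
  qed
  show ?case
    unfolding eval2_pCons partial_X_pCons partial_Y_pCons eval2_add
    by (rule has_derivative_eq_rhs)
       (rule derivative_intros d pCons.IH refl | auto simp: algebra_simps fun_eq_iff)+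
qed

section \<open>Families of functions degenerating to a concave quadratic polynomial\<close>

text \<open>Continuity is joint in the parameter and the point and includes t = 0, so that
  compactness turns facts at t = 0 into facts uniform in z for small t. The derivative is taken in
  the whole plane rather than within \<open>W\<close>, because it has to detect singular points of
  the curve.\<close>

definition C1_family :: "real \<Rightarrow> (real \<times> real) set \<Rightarrow> (real \<Rightarrow> real \<times> real \<Rightarrow> real) \<Rightarrow> bool" where
  "C1_family T W g \<longleftrightarrow> continuous_on ({0..T} \<times> W) (\<lambda>(t, z). g t z) \<and>
     (\<exists>D. continuous_on ({0..T} \<times> W) (\<lambda>(t, z). D t z) \<and>
          (\<forall>t\<in>{0..T}. \<forall>z\<in>W. (g t has_derivative (\<lambda>h. D t z \<bullet> h)) (at z)))"

lemma C1_familyI: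
  fixes D :: "real \<Rightarrow> real \<times> real \<Rightarrow> real \<times> real"
  assumes "continuous_on ({0..T} \<times> W) (\<lambda>p. g (fst p) (snd p))"
    and "continuous_on ({0..T} \<times> W) (\<lambda>p. D (fst p) (snd p))"
    and "\<And>t z. \<lbrakk>t \<in> {0..T}; z \<in> W\<rbrakk> \<Longrightarrow> (g t has_derivative (\<lambda>h. D t z \<bullet> h)) (at z)"
  shows "C1_family T W g"
  using assms unfolding C1_family_def case_prod_beta by blast

lemma C1_familyE:
  assumes "C1_family T W g"
  obtains D :: "real \<Rightarrow> real \<times> real \<Rightarrow> real \<times> real"
  where "continuous_on ({0..T} \<times> W) (\<lambda>p. g (fst p) (snd p))"
    and "continuous_on ({0..T} \<times> W) (\<lambda>p. D (fst p) (snd p))"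
    and "\<And>t z. \<lbrakk>t \<in> {0..T}; z \<in> W\<rbrakk> \<Longrightarrow> (g t has_derivative (\<lambda>h. D t z \<bullet> h)) (at z)"
  using assms unfolding C1_family_def case_prod_beta by blast

lemma C1_family_const [simp]: "C1_family T W (\<lambda>t z. c)"
  by (rule C1_familyI[where D="\<lambda>t z. 0"]) auto

lemma C1_family_fst [simp]: "C1_family T W (\<lambda>t z. fst z)"
  by (rule C1_familyI[where D="\<lambda>t z. (1, 0)"])
     (auto intro!: continuous_intros derivative_eq_intros simp: inner_prod_def)

lemma C1_family_snd [simp]: "C1_family T W (\<lambda>t z. snd z)"
  by (rule C1_familyI[where D="\<lambda>t z. (0, 1)"])
     (auto intro!: continuous_intros derivative_eq_intros simp: inner_prod_def)

lemma C1_family_param [simp]: "C1_family T W (\<lambda>t z. t)"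
  by (rule C1_familyI[where D="\<lambda>t z. 0"]) (auto intro!: continuous_intros)

lemma C1_family_add:
  assumes "C1_family T W f" "C1_family T W g"
  shows "C1_family T W (\<lambda>t z. f t z + g t z)"
proof -
  obtain D where D: "continuous_on ({0..T} \<times> W) (\<lambda>p. f (fst p) (snd p))"
    "continuous_on ({0..T} \<times> W) (\<lambda>p. D (fst p) (snd p))"
    "\<And>t z. \<lbrakk>t \<in> {0..T}; z \<in> W\<rbrakk> \<Longrightarrow> (f t has_derivative (\<lambda>h. D t z \<bullet> h)) (at z)"
    using assms(1) by (rule C1_familyE) blast
  obtain E where E: "continuous_on ({0..T} \<times> W) (\<lambda>p. g (fst p) (snd p))"
    "continuous_on ({0..T} \<times> W) (\<lambda>p. E (fst p) (snd p))"
    "\<And>t z. \<lbrakk>t \<in> {0..T}; z \<in> W\<rbrakk> \<Longrightarrow> (g t has_derivative (\<lambda>h. E t z \<bullet> h)) (at z)"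
    using assms(2) by (rule C1_familyE) blast
  show ?thesis
    by (rule C1_familyI[where D="\<lambda>t z. D t z + E t z"])
       (use D E in \<open>auto intro!: continuous_intros derivative_eq_intros simp: inner_add_left\<close>)
qed

lemma C1_family_mult:
  assumes "C1_family T W f" "C1_family T W g"
  shows "C1_family T W (\<lambda>t z. f t z * g t z)"
proof -
  obtain D where D: "continuous_on ({0..T} \<times> W) (\<lambda>p. f (fst p) (snd p))"
    "continuous_on ({0..T} \<times> W) (\<lambda>p. D (fst p) (snd p))"
    "\<And>t z. \<lbrakk>t \<in> {0..T}; z \<in> W\<rbrakk> \<Longrightarrow> (f t has_derivative (\<lambda>h. D t z \<bullet> h)) (at z)"
    using assms(1) by (rule C1_familyE) blast
  obtain E where E: "continuous_on ({0..T} \<times> W) (\<lambda>p. g (fst p) (snd p))"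
    "continuous_on ({0..T} \<times> W) (\<lambda>p. E (fst p) (snd p))"
    "\<And>t z. \<lbrakk>t \<in> {0..T}; z \<in> W\<rbrakk> \<Longrightarrow> (g t has_derivative (\<lambda>h. E t z \<bullet> h)) (at z)"
    using assms(2) by (rule C1_familyE) blast
  show ?thesis
    by (rule C1_familyI[where D="\<lambda>t z. f t z *\<^sub>R E t z + g t z *\<^sub>R D t z"])
       (use D E in \<open>auto intro!: continuous_intros derivative_eq_intros simp: inner_add_left\<close>)
qed

lemma C1_family_inverse:
  assumes "C1_family T W f" and nz: "\<And>t z. \<lbrakk>t \<in> {0..T}; z \<in> W\<rbrakk> \<Longrightarrow> f t z \<noteq> 0"
  shows "C1_family T W (\<lambda>t z. inverse (f t z))"
proof -
  obtain D where D: "continuous_on ({0..T} \<times> W) (\<lambda>p. f (fst p) (snd p))"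
    "continuous_on ({0..T} \<times> W) (\<lambda>p. D (fst p) (snd p))"
    "\<And>t z. \<lbrakk>t \<in> {0..T}; z \<in> W\<rbrakk> \<Longrightarrow> (f t has_derivative (\<lambda>h. D t z \<bullet> h)) (at z)"
    using assms(1) by (rule C1_familyE) blast
  show ?thesis
    by (rule C1_familyI[where D="\<lambda>t z. - (inverse (f t z) * inverse (f t z)) *\<^sub>R D t z"])
       (use D nz in \<open>auto intro!: continuous_intros derivative_eq_intros\<close>)
qed

lemma C1_family_diff:
  assumes "C1_family T W f" "C1_family T W g"
  shows "C1_family T W (\<lambda>t z. f t z - g t z)"
  using C1_family_add[OF assms(1) C1_family_mult[OF C1_family_const[of T W "-1"] assms(2)]] by simp

lemma C1_family_minus:
  assumes "C1_family T W f"
  shows "C1_family T W (\<lambda>t z. - f t z)"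
  using C1_family_mult[OF C1_family_const[of T W "-1"] assms] by simp

lemma C1_family_power:
  assumes "C1_family T W f"
  shows "C1_family T W (\<lambda>t z. f t z ^ n)"
  by (induction n) (auto intro!: C1_family_mult assms)

lemma C1_family_divide:
  assumes "C1_family T W f" "C1_family T W g" "\<And>t z. \<lbrakk>t \<in> {0..T}; z \<in> W\<rbrakk> \<Longrightarrow> g t z \<noteq> 0"
  shows "C1_family T W (\<lambda>t z. f t z / g t z)"
  unfolding divide_inverse by (intro C1_family_mult C1_family_inverse assms)

lemma C1_family_sum:
  assumes "\<And>a. a \<in> A \<Longrightarrow> C1_family T W (f a)"
  shows "C1_family T W (\<lambda>t z. \<Sum>a\<in>A. f a t z)"
  using assms by (induction A rule: infinite_finite_induct) (auto intro!: C1_family_add)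

text \<open>The pairs (t, z) with a nonnegative value form a compact set. Its projection to the
  parameter axis is compact and misses 0, hence misses an interval to the right of 0.\<close>

lemma eventually_neg_compact:
  fixes h :: "real \<Rightarrow> 'a::euclidean_space \<Rightarrow> real"
  assumes "T > 0" "compact K"
    and cont: "continuous_on ({0..T} \<times> K) (\<lambda>p. h (fst p) (snd p))"
    and neg: "\<And>z. z \<in> K \<Longrightarrow> h 0 z < 0"
  shows "\<forall>\<^sub>F t in at_right 0. \<forall>z\<in>K. h t z < 0"
proof -
  define B where "B = {p \<in> {0..T} \<times> K. h (fst p) (snd p) \<in> {0..}}"
  have "closedin (top_of_set ({0..T} \<times> K)) B"
  proof -
    have "B = ({0..T} \<times> K) \<inter> (\<lambda>p. h (fst p) (snd p)) -` {0..}"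
      by (auto simp: B_def)
    then show ?thesis
      using continuous_closedin_preimage[OF cont closed_atLeast] by simp
  qed
  then have "compact B"
    using closedin_compact[OF compact_Times[OF compact_Icc assms(2)]] by blast
  then have "compact (fst ` B)"
    by (intro compact_continuous_image continuous_intros)
  then have "closed (fst ` B)"
    by (rule compact_imp_closed)
  moreover have "0 \<notin> fst ` B"
    using neg by (fastforce simp: B_def)
  ultimately have "\<forall>\<^sub>F t in nhds 0. t \<in> - (fst ` B)"
    by (intro eventually_nhds_in_open) auto
  then have "\<forall>\<^sub>F t in at_right 0. t \<in> - (fst ` B)"
    by (rule filter_leD[rotated]) (simp add: at_within_def)
  moreover have "\<forall>\<^sub>F t in at_right 0. t \<in> {0<..<T}"
    using eventually_at_right_real[OF \<open>T > 0\<close>] .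
  ultimately show ?thesis
  proof eventually_elim
    case (elim t)
    show ?case
    proof
      fix z assume "z \<in> K"
      moreover from this have "(t, z) \<notin> B" using elim(1) by (force simp: image_iff)
      ultimately show "h t z < 0"
        using elim(2) by (auto simp: B_def)
    qed
  qed
qed

text \<open>On every ray from \<open>z0\<close> the function \<open>g t\<close> starts positive,
  becomes negative before it leaves \<open>W\<close>, and strictly decreases wherever it can vanish.
  So each ray meets the zero set exactly once, and radial projection identifies the zero set with
  the unit circle. The nonzero radial derivative also excludes singular points.\<close>

lemma oval_family:
  fixes g :: "real \<Rightarrow> real \<times> real \<Rightarrow> real" and z0 :: "real \<times> real"
    and A B C \<kappa> \<theta> T :: real
  defines "q \<equiv> \<lambda>h :: real \<times> real. A * (fst h)\<^sup>2 + B * (snd h)\<^sup>2 + C * (fst h + snd h)\<^sup>2"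
  defines "W \<equiv> {z. q (z - z0) \<le> \<kappa> + \<theta>}"
  assumes pos: "A > 0" "B > 0" "C \<ge> 0" "\<kappa> > 0" "\<theta> > 0" "T > 0"
    and fam: "C1_family T W g"
    and U: "open U" "W \<subseteq> U" "\<And>z. z \<in> U \<Longrightarrow> g 0 z = \<kappa> - q (z - z0)"
  shows "\<forall>\<^sub>F t in at_right 0. compact {z \<in> W. g t z = 0} \<and> connected {z \<in> W. g t z = 0} \<and>
           {z \<in> W. g t z = 0} \<noteq> {} \<and>
           (\<forall>z \<in> W. g t z = 0 \<longrightarrow> \<not> (g t has_derivative (\<lambda>_. 0)) (at z))"
proof -
  have q_scale: "q (r *\<^sub>R h) = r\<^sup>2 * q h" for r h
    by (simp add: q_def power2_eq_square algebra_simps)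
  have q_ge: "q h \<ge> A * (fst h)\<^sup>2 + B * (snd h)\<^sup>2" for h
    using pos by (simp add: q_def)
  have q_pos: "q h > 0" if "h \<noteq> 0" for h
  proof -
    have "fst h \<noteq> 0 \<or> snd h \<noteq> 0" using that by (auto simp: prod_eq_iff)
    then have "A * (fst h)\<^sup>2 + B * (snd h)\<^sup>2 > 0"
      using pos by (auto intro: add_pos_nonneg add_nonneg_pos)
    then show ?thesis using q_ge[of h] by linarith
  qed
  have q_cont: "continuous_on S (\<lambda>z. q (z - z0))" for S
    unfolding q_def by (intro continuous_intros)
  have "bounded W"
  proof -
    define \<rho> where "\<rho> = sqrt ((\<kappa> + \<theta>) / A) + sqrt ((\<kappa> + \<theta>) / B)"
    have "norm (z - z0) \<le> \<rho>" if "z \<in> W" for z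
    proof -
      let ?h = "z - z0"
      have le: "A * (fst ?h)\<^sup>2 + B * (snd ?h)\<^sup>2 \<le> \<kappa> + \<theta>"
        using that q_ge[of ?h] by (simp add: W_def)
      have "A * (fst ?h)\<^sup>2 \<le> \<kappa> + \<theta>" "B * (snd ?h)\<^sup>2 \<le> \<kappa> + \<theta>"
        using le pos zero_le_power2[of "fst ?h"] zero_le_power2[of "snd ?h"]
        by (smt (verit) mult_nonneg_nonneg)+
      then have "(fst ?h)\<^sup>2 \<le> (\<kappa> + \<theta>) / A" "(snd ?h)\<^sup>2 \<le> (\<kappa> + \<theta>) / B"
        using pos by (simp_all add: field_simps)
      then have "\<bar>fst ?h\<bar> \<le> sqrt ((\<kappa> + \<theta>) / A)" "\<bar>snd ?h\<bar> \<le> sqrt ((\<kappa> + \<theta>) / B)"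
        by (metis real_sqrt_abs real_sqrt_le_iff)+
      moreover have "norm ?h \<le> \<bar>fst ?h\<bar> + \<bar>snd ?h\<bar>"
        by (metis norm_Pair_le prod.collapse real_norm_def)
      ultimately show ?thesis unfolding \<rho>_def by linarith
    qed
    then have "W \<subseteq> cball z0 \<rho>"
      by (auto simp: dist_norm norm_minus_commute)
    then show ?thesis using bounded_cball bounded_subset by blast
  qed
  moreover have "closed W"
    unfolding W_def by (intro closed_Collect_le q_cont continuous_intros)
  ultimately have W: "compact W" by (simp add: compact_eq_bounded_closed)
  obtain D where gc: "continuous_on ({0..T} \<times> W) (\<lambda>p. g (fst p) (snd p))"
    and Dc: "continuous_on ({0..T} \<times> W) (\<lambda>p. D (fst p) (snd p))"
    and gD: "\<And>t z. \<lbrakk>t \<in> {0..T}; z \<in> W\<rbrakk> \<Longrightarrow> (g t has_derivative (\<lambda>h. D t z \<bullet> h)) (at z)"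
    using fam by (rule C1_familyE) blast
  \<comment> \<open>\<open>K2\<close> will carry positivity, the boundary \<open>K3\<close>
    negativity, and \<open>K1\<close> radial decrease. The cut at half of the maximum keeps
    \<open>K1\<close> away from \<open>z0\<close>, where the radial derivative vanishes, and
    \<open>K2\<close> away from the ellipse.\<close>
  define K1 where "K1 = {z. q (z - z0) \<ge> \<kappa> / 2} \<inter> W"
  define K2 where "K2 = {z. q (z - z0) \<le> \<kappa> / 2} \<inter> W"
  define K3 where "K3 = {z. q (z - z0) = \<kappa> + \<theta>} \<inter> W"
  have K: "compact K1" "compact K2" "compact K3"
    unfolding K1_def K2_def K3_def
    by (intro closed_Int_compact W closed_Collect_le closed_Collect_eq q_cont continuous_intros)+
  \<comment> \<open>Euler's identity for the homogeneous quadratic \<open>q\<close>. The formula for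
    \<open>g 0\<close> holds on the open set \<open>U\<close>, so it determines the derivative at
    the boundary of \<open>W\<close> too.\<close>
  have radial0: "D 0 z \<bullet> (z - z0) = - 2 * q (z - z0)" if "z \<in> W" for z
  proof -
    have "(g 0 has_derivative (\<lambda>h. D 0 z \<bullet> h)) (at z)"
      using gD that pos by simp
    moreover have "((\<lambda>z. \<kappa> - q (z - z0)) has_derivative
        (\<lambda>h. - (2 * A * fst (z - z0) * fst h + 2 * B * snd (z - z0) * snd h
               + 2 * C * (fst (z - z0) + snd (z - z0)) * (fst h + snd h)))) (at z)"
      unfolding q_def by (auto intro!: derivative_eq_intros simp: algebra_simps)
    then have "(g 0 has_derivative
        (\<lambda>h. - (2 * A * fst (z - z0) * fst h + 2 * B * snd (z - z0) * snd h
               + 2 * C * (fst (z - z0) + snd (z - z0)) * (fst h + snd h)))) (at z)"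
      by (rule has_derivative_transform_within_open[OF _ U(1)]) (use that U in auto)
    ultimately have "(\<lambda>h. D 0 z \<bullet> h) =
        (\<lambda>h. - (2 * A * fst (z - z0) * fst h + 2 * B * snd (z - z0) * snd h
               + 2 * C * (fst (z - z0) + snd (z - z0)) * (fst h + snd h)))"
      by (rule has_derivative_unique)
    from fun_cong[OF this, of "z - z0"] show ?thesis
      by (simp add: q_def power2_eq_square algebra_simps)
  qed
  have sub: "{0..T} \<times> K1 \<subseteq> {0..T} \<times> W" "{0..T} \<times> K2 \<subseteq> {0..T} \<times> W" "{0..T} \<times> K3 \<subseteq> {0..T} \<times> W"
    by (auto simp: K1_def K2_def K3_def)
  have "\<forall>\<^sub>F t in at_right 0. \<forall>z\<in>K1. D t z \<bullet> (z - z0) < 0"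
  proof (rule eventually_neg_compact[OF \<open>T > 0\<close> K(1)])
    show "continuous_on ({0..T} \<times> K1) (\<lambda>p. D (fst p) (snd p) \<bullet> (snd p - z0))"
      by (intro continuous_intros continuous_on_subset[OF Dc sub(1)])
    show "D 0 z \<bullet> (z - z0) < 0" if "z \<in> K1" for z
      using that radial0[of z] pos by (auto simp: K1_def)
  qed
  moreover have "\<forall>\<^sub>F t in at_right 0. \<forall>z\<in>K2. - g t z < 0"
  proof (rule eventually_neg_compact[OF \<open>T > 0\<close> K(2)])
    show "continuous_on ({0..T} \<times> K2) (\<lambda>p. - g (fst p) (snd p))"
      by (intro continuous_intros continuous_on_subset[OF gc sub(2)])
    show "- g 0 z < 0" if "z \<in> K2" for z
    proof -
      have "z \<in> U" using that U(2) by (auto simp: K2_def)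
      then show ?thesis using U(3)[of z] that pos by (auto simp: K2_def)
    qed
  qed
  moreover have "\<forall>\<^sub>F t in at_right 0. \<forall>z\<in>K3. g t z < 0"
  proof (rule eventually_neg_compact[OF \<open>T > 0\<close> K(3)])
    show "continuous_on ({0..T} \<times> K3) (\<lambda>p. g (fst p) (snd p))"
      by (intro continuous_intros continuous_on_subset[OF gc sub(3)])
    show "g 0 z < 0" if "z \<in> K3" for z
    proof -
      have "z \<in> U" using that U(2) by (auto simp: K3_def)
      then show ?thesis using U(3)[of z] that pos by (auto simp: K3_def)
    qed
  qed
  moreover have "\<forall>\<^sub>F t in at_right 0. t \<in> {0<..<T}"
    using eventually_at_right_real[OF \<open>T > 0\<close>] .
  ultimately show ?thesis
  proof eventually_elim
    case (elim t)
    define Z where "Z = {z \<in> W. g t z = 0}"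
    have tT: "t \<in> {0..T}" using elim by auto
    have dg: "(g t has_derivative (\<lambda>h. D t z \<bullet> h)) (at z)" if "z \<in> W" for z
      using gD tT that by blast
    have cg: "continuous_on W (g t)"
      by (meson dg continuous_at_imp_continuous_on has_derivative_continuous)
    have ZK1: "z \<in> K1" if "z \<in> W" "g t z \<le> 0" for z
    proof -
      have "z \<notin> K2" using elim(2) that by (meson leD neg_less_0_iff_less)
      then show ?thesis using that by (auto simp: K1_def K2_def)
    qed
    have neg: "D t z \<bullet> (z - z0) < 0" if "z \<in> W" "g t z \<le> 0" for z
      using ZK1[OF that] elim(1) by blast
    have Zc: "compact Z"
    proof -
      have "Z = W \<inter> g t -` {0}" by (auto simp: Z_def)
      then have "closedin (top_of_set W) Z"
        using continuous_closedin_preimage[OF cg closed_singleton] by simp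
      then show ?thesis using W closedin_compact by blast
    qed
    have ne: "z \<noteq> z0" if "z \<in> Z" for z
      using neg[of z] that by (auto simp: Z_def)
    define \<phi> where "\<phi> z = (z - z0) /\<^sub>R norm (z - z0)" for z
    have \<phi>c: "continuous_on Z \<phi>"
      unfolding \<phi>_def by (intro continuous_intros) (use ne in auto)
    have ray: "r *\<^sub>R \<omega> + z0 \<in> W \<longleftrightarrow> r\<^sup>2 * q \<omega> \<le> \<kappa> + \<theta>" for r \<omega>
      by (simp add: W_def q_scale)
    \<comment> \<open>Along a ray \<open>q\<close> grows with the square of the radius, so the
      segment between two zeros stays in \<open>K1\<close>, where \<open>g t\<close> strictly
      decreases.\<close>
    have unique: False if z: "r1 *\<^sub>R \<omega> + z0 \<in> Z" "r2 *\<^sub>R \<omega> + z0 \<in> Z" and r: "0 < r1" "r1 < r2" for r1 r2 \<omega>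
    proof -
      have w0: "\<omega> \<noteq> 0" using ne[OF z(1)] by auto
      have inK: "r *\<^sub>R \<omega> + z0 \<in> K1" if "r1 \<le> r" "r \<le> r2" for r
      proof -
        have "r1\<^sup>2 * q \<omega> \<ge> \<kappa> / 2" "r2\<^sup>2 * q \<omega> \<le> \<kappa> + \<theta>"
          using z ZK1[of "r1 *\<^sub>R \<omega> + z0"] ray[of r2 \<omega>] by (auto simp: Z_def K1_def q_scale)
        moreover have "r1\<^sup>2 * q \<omega> \<le> r\<^sup>2 * q \<omega>" "r\<^sup>2 * q \<omega> \<le> r2\<^sup>2 * q \<omega>"
          using that r q_pos[OF w0] by (auto intro!: mult_right_mono power_mono)
        ultimately show ?thesis using ray[of r \<omega>] by (auto simp: K1_def q_scale)
      qed
      have "g t (r1 *\<^sub>R \<omega> + z0) > g t (r2 *\<^sub>R \<omega> + z0)"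
      proof (rule DERIV_neg_imp_decreasing[OF r(2)])
        fix r assume r': "r1 \<le> r" "r \<le> r2"
        let ?z = "r *\<^sub>R \<omega> + z0"
        have "D t ?z \<bullet> (?z - z0) < 0" using elim(1) inK[OF r'] by blast
        then have "D t ?z \<bullet> \<omega> < 0"
          using r r' by (simp add: mult_less_0_iff)
        moreover have "((\<lambda>r. g t (r *\<^sub>R \<omega> + z0)) has_derivative (\<lambda>h. D t ?z \<bullet> (h *\<^sub>R \<omega>))) (at r)"
          using inK[OF r']
          by (intro has_derivative_compose[where f="\<lambda>r. r *\<^sub>R \<omega> + z0" and g="g t"] dg)
             (auto intro!: derivative_eq_intros simp: K1_def)
        then have "((\<lambda>r. g t (r *\<^sub>R \<omega> + z0)) has_real_derivative D t ?z \<bullet> \<omega>) (at r)"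
          unfolding has_field_derivative_def by (rule has_derivative_eq_rhs) (auto simp: fun_eq_iff)
        ultimately show "\<exists>y. ((\<lambda>r. g t (r *\<^sub>R \<omega> + z0)) has_real_derivative y) (at r) \<and> y < 0"
          by blast
      qed
      then show False using z by (simp add: Z_def)
    qed
    have polar: "norm (z - z0) *\<^sub>R \<phi> z + z0 = z" if "z \<in> Z" for z
      using ne[OF that] by (simp add: \<phi>_def)
    have inj: "inj_on \<phi> Z"
    proof (rule inj_onI)
      fix z1 z2 assume z: "z1 \<in> Z" "z2 \<in> Z" "\<phi> z1 = \<phi> z2"
      have "norm (z1 - z0) > 0" "norm (z2 - z0) > 0" using ne z by auto
      then have "norm (z1 - z0) = norm (z2 - z0)"
        using unique[of "norm (z1 - z0)" "\<phi> z1" "norm (z2 - z0)"]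
              unique[of "norm (z2 - z0)" "\<phi> z1" "norm (z1 - z0)"] polar[OF z(1)] polar[OF z(2)] z
        by (metis linorder_neqE_linordered_idom)
      then show "z1 = z2" using polar[OF z(1)] polar[OF z(2)] z(3) by metis
    qed
    have img: "\<phi> ` Z = sphere 0 1"
    proof (intro subset_antisym subsetI)
      fix w assume "w \<in> \<phi> ` Z"
      then show "w \<in> sphere 0 1" using ne by (auto simp: \<phi>_def)
    next
      fix \<omega> :: "real \<times> real" assume "\<omega> \<in> sphere 0 1"
      then have n1: "norm \<omega> = 1" and w0: "\<omega> \<noteq> 0" by auto
      define R where "R = sqrt ((\<kappa> + \<theta>) / q \<omega>)"
      have R: "R > 0" "R\<^sup>2 * q \<omega> = \<kappa> + \<theta>"
        using pos q_pos[OF w0] by (simp_all add: R_def)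
      have le: "r\<^sup>2 * q \<omega> \<le> \<kappa> + \<theta>" if "0 \<le> r" "r \<le> R" for r
        using that q_pos[OF w0] unfolding R(2)[symmetric] by (intro mult_right_mono power_mono) auto
      have "g t (0 *\<^sub>R \<omega> + z0) \<ge> 0"
      proof -
        have "z0 \<in> K2" using pos by (simp add: K2_def W_def q_def)
        then show ?thesis using elim(2) by fastforce
      qed
      moreover have "g t (R *\<^sub>R \<omega> + z0) \<le> 0"
      proof -
        have "R *\<^sub>R \<omega> + z0 \<in> K3" using R ray[of R \<omega>] by (simp add: K3_def q_scale)
        then show ?thesis using elim(3) by fastforce
      qed
      moreover have "continuous_on {0..R} (\<lambda>r. g t (r *\<^sub>R \<omega> + z0))"
      proof (rule continuous_on_compose2[OF cg])
        show "(\<lambda>r. r *\<^sub>R \<omega> + z0) ` {0..R} \<subseteq> W"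
          by (intro image_subsetI) (simp only: ray le atLeastAtMost_iff)
      qed (intro continuous_intros)
      ultimately obtain r where r: "0 \<le> r" "r \<le> R" "g t (r *\<^sub>R \<omega> + z0) = 0"
        using IVT2'[of "\<lambda>r. g t (r *\<^sub>R \<omega> + z0)" R 0 0] R(1) by auto
      then have Z: "r *\<^sub>R \<omega> + z0 \<in> Z" using le ray by (auto simp: Z_def)
      then have "r \<noteq> 0" using ne by fastforce
      then have "\<phi> (r *\<^sub>R \<omega> + z0) = \<omega>" using r n1 by (simp add: \<phi>_def)
      then show "\<omega> \<in> \<phi> ` Z" using Z by force
    qed
    \<comment> \<open>A continuous bijection from a compact set onto the circle has a continuous
      inverse, which carries connectedness of the circle back to \<open>Z\<close>.\<close>
    obtain \<psi> where "homeomorphism Z (sphere 0 1) \<phi> \<psi>"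
      using homeomorphism_compact[OF Zc \<phi>c img inj] by blast
    then have "Z = \<psi> ` sphere 0 1" "continuous_on (sphere 0 1) \<psi>"
      by (auto simp: homeomorphism_def)
    then have "connected Z"
      by (simp add: connected_continuous_image connected_sphere)
    moreover have "(1, 0) \<in> \<phi> ` Z" unfolding img by (simp add: norm_Pair)
    then have "Z \<noteq> {}" by blast
    moreover have "\<not> (g t has_derivative (\<lambda>_. 0)) (at z)" if "z \<in> W" "g t z = 0" for z
    proof
      assume "(g t has_derivative (\<lambda>_. 0)) (at z)"
      then have "D t z \<bullet> (z - z0) = 0"
        using has_derivative_unique[OF dg[OF that(1)]] by (metis (full_types))
      then show False using neg[of z] that by simp
    qed
    ultimately show ?case
      using Zc unfolding Z_def by blast
  qed
qed

section \<open>The Hessian of the patchworked polynomial\<close>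

definition tri :: "nat \<Rightarrow> (nat \<times> nat) set" where
  "tri k = {(i, j). i + j \<le> k}"

text \<open>The second derivatives of a term \<open>c X^(i + 1) Y^(j + 1)\<close> are these weights times
  \<open>c X^i Y^j\<close>, up to factors \<open>Y / X\<close>, \<open>1\<close> and \<open>X / Y\<close> that cancel in the Hessian. Hence the Hessian
  is a quadratic form in the values of \<open>term_at\<close>, even on the coordinate axes.\<close>

definition wxx :: "nat \<times> nat \<Rightarrow> real" where "wxx q = (real (fst q) + 1) * real (fst q)"
definition wxy :: "nat \<times> nat \<Rightarrow> real" where "wxy q = (real (fst q) + 1) * (real (snd q) + 1)"
definition wyy :: "nat \<times> nat \<Rightarrow> real" where "wyy q = (real (snd q) + 1) * real (snd q)"

definition hess_form :: "(nat \<times> nat) set \<Rightarrow> (nat \<times> nat \<Rightarrow> real) \<Rightarrow> real" where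
  "hess_form S f = (\<Sum>q\<in>S. f q * wxx q) * (\<Sum>q\<in>S. f q * wyy q) - (\<Sum>q\<in>S. f q * wxy q)\<^sup>2"

text \<open>The mixed second difference is the coefficient 2 of the cross term: (i, j) and (i + 1, j
  + 1) together lie 2 higher than (i + 1, j) and (i, j + 1). Hence each unit square is cut along the
  side joining the latter two.\<close>

definition ht :: "nat \<times> nat \<Rightarrow> nat" where
  "ht q = 3 * (fst q)\<^sup>2 + 2 * fst q * snd q + 3 * (snd q)\<^sup>2"

definition term_at :: "real \<Rightarrow> real \<times> real \<Rightarrow> nat \<times> nat \<Rightarrow> real" where
  "term_at t z q = (-1) ^ (fst q + snd q) * t ^ ht q * fst z ^ fst q * snd z ^ snd q"

definition patch_poly :: "nat \<Rightarrow> real \<Rightarrow> real poly poly" where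
  "patch_poly k t = (\<Sum>q\<in>tri k. monom (monom ((-1) ^ (fst q + snd q) * t ^ ht q) (fst q + 1)) (snd q + 1))"

lemma finite_tri [simp]: "finite (tri k)"
  by (rule finite_subset[of _ "{..k} \<times> {..k}"]) (auto simp: tri_def)

lemma eval2_Hess_patch_poly:
  "eval2 (Hess (patch_poly k t)) x y = hess_form (tri k) (term_at t (x, y))"
proof -
  let ?c = "\<lambda>q. (-1) ^ (fst q + snd q) * t ^ ht q :: real"
  have XX: "eval2 (partial_X (partial_X (patch_poly k t))) x y =
      (\<Sum>q\<in>tri k. ?c q * wxx q * x ^ (fst q - 1) * y ^ (snd q + 1))"
    unfolding patch_poly_def partial_X_sum partial_X_monom eval2_sum eval2_monom
    by (intro sum.cong) (auto simp: wxx_def algebra_simps)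
  have YY: "eval2 (partial_Y (partial_Y (patch_poly k t))) x y =
      (\<Sum>q\<in>tri k. ?c q * wyy q * x ^ (fst q + 1) * y ^ (snd q - 1))"
    unfolding patch_poly_def partial_Y_sum partial_Y_monom eval2_sum eval2_monom
    by (intro sum.cong) (auto simp: wyy_def algebra_simps)
  have XY: "eval2 (partial_X (partial_Y (patch_poly k t))) x y = (\<Sum>q\<in>tri k. term_at t (x, y) q * wxy q)"
    unfolding patch_poly_def partial_Y_sum partial_Y_monom partial_X_sum partial_X_monom eval2_sum eval2_monom
    by (intro sum.cong) (auto simp: wxy_def term_at_def algebra_simps)
  \<comment> \<open>The factors Y/X and X/Y cancel in each product. Where a truncated exponent
    \<open>fst q - 1\<close> or \<open>snd r - 1\<close> would spoil this, the weight
    \<open>wxx q\<close> or \<open>wyy r\<close> is zero.\<close>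
  have "?c q * wxx q * x ^ (fst q - 1) * y ^ (snd q + 1) * (?c r * wyy r * x ^ (fst r + 1) * y ^ (snd r - 1))
      = term_at t (x, y) q * wxx q * (term_at t (x, y) r * wyy r)" for q r
  proof (cases "fst q = 0 \<or> snd r = 0")
    case True
    then show ?thesis by (auto simp: wxx_def wyy_def)
  next
    case False
    then obtain m n where "fst q = Suc m" "snd r = Suc n" by (meson not0_implies_Suc)
    then show ?thesis by (simp add: term_at_def algebra_simps)
  qed
  then have "eval2 (partial_X (partial_X (patch_poly k t))) x y * eval2 (partial_Y (partial_Y (patch_poly k t))) x y
      = (\<Sum>q\<in>tri k. term_at t (x, y) q * wxx q) * (\<Sum>q\<in>tri k. term_at t (x, y) q * wyy q)"
    unfolding XX YY sum_product by (simp only:)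
  then show ?thesis
    by (simp add: Hess_def eval2_diff eval2_mult eval2_power hess_form_def XY)
qed

lemma total_deg_patch_poly:
  assumes "t \<noteq> 0"
  shows "total_deg (patch_poly k t) = k + 2"
proof -
  let ?c = "\<lambda>q. (-1) ^ (fst q + snd q) * t ^ ht q :: real"
  \<comment> \<open>The conditions \<open>i \<ge> 1\<close> and \<open>j \<ge> 1\<close> are there
    because truncated subtraction would confuse exponent 0 with exponent 1.\<close>
  have coeff: "coeff (coeff (patch_poly k t) j) i =
      (\<Sum>q\<in>tri k. if q = (i - 1, j - 1) \<and> i \<ge> 1 \<and> j \<ge> 1 then ?c q else 0)" for i j
    unfolding patch_poly_def coeff_sum
    by (intro sum.cong) (auto simp: prod_eq_iff)
  have coeff_iff: "coeff (coeff (patch_poly k t) j) i \<noteq> 0 \<longleftrightarrow> i \<ge> 1 \<and> j \<ge> 1 \<and> i + j \<le> k + 2" for i j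
  proof (cases "i \<ge> 1 \<and> j \<ge> 1")
    case True
    then have "coeff (coeff (patch_poly k t) j) i = (if (i - 1, j - 1) \<in> tri k then ?c (i - 1, j - 1) else 0)"
      unfolding coeff by simp
    then show ?thesis using True assms by (auto simp: tri_def)
  qed (auto simp: coeff)
  have "insert 0 {i + j | i j. coeff (coeff (patch_poly k t) j) i \<noteq> 0} = insert 0 {2..k + 2}"
  proof -
    have "\<exists>i j. n = i + j \<and> i \<ge> 1 \<and> j \<ge> 1 \<and> i + j \<le> k + 2" if "n \<in> {2..k + 2}" for n
      using that by (intro exI[of _ 1] exI[of _ "n - 1"]) auto
    then show ?thesis unfolding coeff_iff by auto
  qed
  then show ?thesis
    unfolding total_deg_def by (intro Max_eqI) auto
qed

section \<open>Perturbation bound and normal forms of the Hessian form\<close>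

lemma hess_form_scale: "hess_form S (\<lambda>q. c * f q) = c\<^sup>2 * hess_form S f"
  by (simp add: hess_form_def mult.assoc sum_distrib_left[symmetric] power2_eq_square algebra_simps)

lemma hess_form_cong: "(\<And>q. q \<in> S \<Longrightarrow> f q = g q) \<Longrightarrow> hess_form S f = hess_form S g"
  by (simp add: hess_form_def)

text \<open>The error is measured against the size \<open>M\<close> of the terms, and
  \<open>C\<close> depends on \<open>k\<close> alone. This is what makes the later estimates uniform
  over all points of the plane.\<close>

lemma hess_form_perturb:
  fixes k :: nat
  obtains C where "C > 0"
    and "\<And>f g M \<epsilon>. \<lbrakk>\<And>q. q \<in> tri k \<Longrightarrow> \<bar>f q\<bar> \<le> M; \<And>q. q \<in> tri k \<Longrightarrow> \<bar>g q\<bar> \<le> M;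
           \<And>q. q \<in> tri k \<Longrightarrow> \<bar>f q - g q\<bar> \<le> \<epsilon> * M; M \<ge> 0; \<epsilon> \<ge> 0\<rbrakk>
           \<Longrightarrow> \<bar>hess_form (tri k) f - hess_form (tri k) g\<bar> \<le> C * \<epsilon> * M\<^sup>2"
proof
  define s where "s = (\<Sum>q\<in>tri k. wxx q + wxy q + wyy q)"
  have w0: "wxx q \<ge> 0" "wxy q \<ge> 0" "wyy q \<ge> 0" for q
    by (simp_all add: wxx_def wxy_def wyy_def)
  have s0: "s \<ge> 0" unfolding s_def by (intro sum_nonneg) (simp add: w0)
  show "4 * s\<^sup>2 + 1 > 0" using zero_le_power2[of s] by linarith
  fix f g :: "nat \<times> nat \<Rightarrow> real" and M \<epsilon> :: real
  assume f: "\<And>q. q \<in> tri k \<Longrightarrow> \<bar>f q\<bar> \<le> M" and g: "\<And>q. q \<in> tri k \<Longrightarrow> \<bar>g q\<bar> \<le> M"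
    and fg: "\<And>q. q \<in> tri k \<Longrightarrow> \<bar>f q - g q\<bar> \<le> \<epsilon> * M" and M: "M \<ge> 0" "\<epsilon> \<ge> 0"
  have bound: "\<bar>\<Sum>q\<in>tri k. h q * w q\<bar> \<le> s * m"
    if "\<And>q. q \<in> tri k \<Longrightarrow> \<bar>h q\<bar> \<le> m" "m \<ge> 0" "\<And>q. w q \<ge> 0" "\<And>q. w q \<le> wxx q + wxy q + wyy q"
    for h w :: "nat \<times> nat \<Rightarrow> real" and m
  proof -
    have "\<bar>\<Sum>q\<in>tri k. h q * w q\<bar> \<le> (\<Sum>q\<in>tri k. (wxx q + wxy q + wyy q) * m)"
    proof (rule order_trans[OF sum_abs sum_mono])
      fix q assume "q \<in> tri k"
      then have "\<bar>h q\<bar> * w q \<le> m * (wxx q + wxy q + wyy q)"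
        using that by (intro mult_mono) auto
      then show "\<bar>h q * w q\<bar> \<le> (wxx q + wxy q + wyy q) * m"
        using that(3)[of q] by (simp add: abs_mult mult.commute)
    qed
    then show ?thesis by (simp add: s_def sum_distrib_right)
  qed
  define F G where "F w = (\<Sum>q\<in>tri k. f q * w q)" and "G w = (\<Sum>q\<in>tri k. g q * w q)" for w
  have FG: "F w - G w = (\<Sum>q\<in>tri k. (f q - g q) * w q)" for w
    by (simp add: F_def G_def sum_subtractf algebra_simps)
  have prod: "\<bar>F v * F w - G v * G w\<bar> \<le> 2 * s\<^sup>2 * \<epsilon> * M\<^sup>2"
    if "v \<in> {wxx, wxy, wyy}" "w \<in> {wxx, wxy, wyy}" for v w
  proof -
    have vw: "v q \<ge> 0" "v q \<le> wxx q + wxy q + wyy q" "w q \<ge> 0" "w q \<le> wxx q + wxy q + wyy q" for q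
      using that w0[of q] by auto
    have b: "\<bar>F w\<bar> \<le> s * M" "\<bar>G v\<bar> \<le> s * M" "\<bar>F v - G v\<bar> \<le> s * (\<epsilon> * M)" "\<bar>F w - G w\<bar> \<le> s * (\<epsilon> * M)"
      unfolding FG unfolding F_def G_def
      by (rule bound; use f g fg M vw in simp)+
    have "F v * F w - G v * G w = (F v - G v) * F w + G v * (F w - G w)"
      by (simp add: algebra_simps)
    also have "\<bar>\<dots>\<bar> \<le> s * (\<epsilon> * M) * (s * M) + s * M * (s * (\<epsilon> * M))"
      using b s0 M unfolding abs_mult
      by (intro order_trans[OF abs_triangle_ineq] add_mono) (auto simp: abs_mult intro!: mult_mono)
    finally show ?thesis by (simp add: power2_eq_square algebra_simps)
  qed
  have "hess_form (tri k) f - hess_form (tri k) g = (F wxx * F wyy - G wxx * G wyy) - (F wxy * F wxy - G wxy * G wxy)"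
    by (simp add: hess_form_def F_def G_def power2_eq_square)
  then have "\<bar>hess_form (tri k) f - hess_form (tri k) g\<bar> \<le> 4 * s\<^sup>2 * \<epsilon> * M\<^sup>2"
    using prod[of wxx wyy] prod[of wxy wxy] by simp
  also have "\<dots> \<le> (4 * s\<^sup>2 + 1) * \<epsilon> * M\<^sup>2"
    using M by (simp add: algebra_simps)
  finally show "\<bar>hess_form (tri k) f - hess_form (tri k) g\<bar> \<le> (4 * s\<^sup>2 + 1) * \<epsilon> * M\<^sup>2" .
qed

text \<open>The Hessian form of three terms on an upward triangle, arranged in squares (see
  \<open>hess_form_up\<close>). At \<open>u = 0\<close> it is negative definite in \<open>v\<close>
  and \<open>w\<close>, which is the degenerate situation of a downward triangle.\<close>

definition cell_form :: "nat \<Rightarrow> nat \<Rightarrow> real \<Rightarrow> real \<Rightarrow> real \<Rightarrow> real" where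
  "cell_form i j u v w = (let a = real i + 1; b = real j + 1; m = a + b in
     a * b * u\<^sup>2 - b * m * v\<^sup>2 - a * m * w\<^sup>2 - a * b * m * (u + v + w)\<^sup>2)"

lemma hess_form_up:
  assumes "i + j + 1 \<le> k"
    and "\<And>q. q \<in> tri k - {(i, j), (i + 1, j), (i, j + 1)} \<Longrightarrow> f q = 0"
  shows "hess_form (tri k) f = cell_form i j (f (i, j)) (f (i + 1, j)) (f (i, j + 1))"
proof -
  have "(\<Sum>q\<in>tri k. f q * w q) = f (i, j) * w (i, j) + f (i + 1, j) * w (i + 1, j) + f (i, j + 1) * w (i, j + 1)"
    for w :: "nat \<times> nat \<Rightarrow> real"
  proof -
    have "(\<Sum>q\<in>tri k. f q * w q) = (\<Sum>q\<in>{(i, j), (i + 1, j), (i, j + 1)}. f q * w q)"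
      using assms by (intro sum.mono_neutral_right[OF finite_tri]) (auto simp: tri_def)
    then show ?thesis by simp
  qed
  then show ?thesis
    unfolding hess_form_def cell_form_def Let_def wxx_def wxy_def wyy_def fst_conv snd_conv
    by (simp add: power2_eq_square) (simp add: algebra_simps)
qed

lemma hess_form_eqI:
  assumes "\<And>w. w \<in> {wxx, wxy, wyy} \<Longrightarrow> (\<Sum>q\<in>S. f q * w q) = (\<Sum>q\<in>S. g q * w q)"
  shows "hess_form S f = hess_form S g"
  using assms by (simp add: hess_form_def)

text \<open>All three weights satisfy the same linear relation between the vertices of a downward
  triangle. The value at \<open>(i + 1, j + 1)\<close> can therefore be moved onto the other two
  vertices without changing any of the sums in \<open>hess_form\<close>; these two also belong to
  the upward triangle at \<open>(i, j)\<close>.\<close>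

lemma hess_form_down_reduce:
  fixes i j k :: nat
  defines "X0 \<equiv> (real i + 2) / (real i + real j + 2)" and "Y0 \<equiv> (real j + 2) / (real i + real j + 2)"
  assumes "i + j + 2 \<le> k"
  shows "hess_form (tri k) f = hess_form (tri k)
    (f((i + 1, j + 1) := 0, (i, j + 1) := f (i, j + 1) + X0 * f (i + 1, j + 1),
       (i + 1, j) := f (i + 1, j) + Y0 * f (i + 1, j + 1)))" (is "_ = hess_form _ ?g")
proof (rule hess_form_eqI)
  fix w assume "w \<in> {wxx, wxy, wyy}"
  then have w: "w (i + 1, j + 1) = X0 * w (i, j + 1) + Y0 * w (i + 1, j)"
    unfolding X0_def Y0_def
    by (auto simp: wxx_def wxy_def wyy_def times_divide_eq_left add_divide_distrib[symmetric] eq_divide_eq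
        algebra_simps)
  have "(\<Sum>q\<in>tri k. ?g q * w q) - (\<Sum>q\<in>tri k. f q * w q) = (\<Sum>q\<in>tri k. (?g q - f q) * w q)"
    by (simp add: sum_subtractf algebra_simps)
  also have "\<dots> = (\<Sum>q\<in>{(i + 1, j + 1), (i, j + 1), (i + 1, j)}. (?g q - f q) * w q)"
    using assms by (intro sum.mono_neutral_right[OF finite_tri]) (auto simp: tri_def)
  also have "\<dots> = 0" using w by (simp add: algebra_simps)
  finally show "(\<Sum>q\<in>tri k. f q * w q) = (\<Sum>q\<in>tri k. ?g q * w q)" by simp
qed

section \<open>Localisation of the dominant terms\<close>

lemma cell_form_scale: "cell_form i j (c * u) (c * v) (c * w) = c\<^sup>2 * cell_form i j u v w"
proof -
  have "a * b * (c * u)\<^sup>2 - b * m * (c * v)\<^sup>2 - a * m * (c * w)\<^sup>2 - a * b * m * (c * u + c * v + c * w)\<^sup>2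
      = c\<^sup>2 * (a * b * u\<^sup>2 - b * m * v\<^sup>2 - a * m * w\<^sup>2 - a * b * m * (u + v + w)\<^sup>2)" for a b m :: real
    by algebra
  then show ?thesis by (simp only: cell_form_def Let_def)
qed

text \<open>The coefficient of \<open>u\<^sup>2\<close> is positive but no larger than those
  subtracted for \<open>v\<^sup>2\<close> and \<open>w\<^sup>2\<close>. So where the Hessian is
  almost nonnegative, the corner value controls the other two; for \<open>u = 0\<close> both of
  these must be small.\<close>

lemma cell_form_bounds:
  assumes "cell_form i j u v w \<ge> - \<delta>" "\<delta> \<ge> 0"
  shows "v\<^sup>2 \<le> u\<^sup>2 + \<delta>" "w\<^sup>2 \<le> u\<^sup>2 + \<delta>"
proof -
  define a b m where "a = real i + 1" and "b = real j + 1" and "m = a + b"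
  have ab: "a \<ge> 1" "b \<ge> 1" "m \<ge> 1" "a \<le> m" "b \<le> m" by (auto simp: a_def b_def m_def)
  have "a * b * m * (u + v + w)\<^sup>2 \<ge> 0" "b * m * v\<^sup>2 \<ge> 0" "a * m * w\<^sup>2 \<ge> 0"
    using ab by (auto intro!: mult_nonneg_nonneg)
  then have le: "b * m * v\<^sup>2 \<le> a * b * u\<^sup>2 + \<delta>" "a * m * w\<^sup>2 \<le> a * b * u\<^sup>2 + \<delta>"
    using assms(1) unfolding cell_form_def Let_def a_def[symmetric] b_def[symmetric] m_def[symmetric] by linarith+
  have 1: "a * b * u\<^sup>2 \<le> b * m * u\<^sup>2" "a * b * u\<^sup>2 \<le> a * m * u\<^sup>2"
    using ab by (auto intro!: mult_right_mono)
  have 2: "\<delta> \<le> b * m * \<delta>" "\<delta> \<le> a * m * \<delta>"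
    using mult_right_mono[OF mult_mono[of 1 b 1 m] assms(2)] mult_right_mono[OF mult_mono[of 1 a 1 m] assms(2)] ab
    by simp_all
  have "b * m * v\<^sup>2 \<le> b * m * (u\<^sup>2 + \<delta>)" "a * m * w\<^sup>2 \<le> a * m * (u\<^sup>2 + \<delta>)"
    using le 1 2 by (simp_all add: distrib_left)
  moreover have "b * m > 0" "a * m > 0" using ab by auto
  ultimately show "v\<^sup>2 \<le> u\<^sup>2 + \<delta>" "w\<^sup>2 \<le> u\<^sup>2 + \<delta>"
    by (simp_all only: mult_le_cancel_left_pos)
qed

text \<open>The ellipse \<open>cell_form \<ge> 0\<close> in the ratios \<open>- v / u\<close>,
  \<open>- w / u\<close>, enlarged by a margin. The margin leaves room for perturbed ovals, yet is
  small enough for the lower bounds in \<open>cell_box_bounds\<close>.\<close>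

definition cell_box :: "nat \<Rightarrow> nat \<Rightarrow> (real \<times> real) set" where
  "cell_box i j = {z. cell_form i j 1 (- fst z) (- snd z) \<ge>
      - ((real i + 1) * (real j + 1) / (2 * (real i + real j + 2)))}"

text \<open>Up to the factor \<open>a * b\<close> the left side is 1 minus m times x^2 / a + y^2 / b
  + (1 - x - y)^2. By Cauchy-Schwarz this sum of squares is least when x, y and 1 - x - y are in the
  ratio a : b : 1, which gives the centre.\<close>

lemma cell_form_centre:
  fixes i j :: nat
  defines "a \<equiv> real i + 1" and "b \<equiv> real j + 1"
  defines "m \<equiv> a + b"
  shows "cell_form i j 1 (- x) (- y) = a * b / (m + 1)
     - (b * m * (x - a / (m + 1))\<^sup>2 + a * m * (y - b / (m + 1))\<^sup>2
        + a * b * m * ((x - a / (m + 1)) + (y - b / (m + 1)))\<^sup>2)"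
proof -
  define p r where "p = a / (m + 1)" and "r = b / (m + 1)"
  have "m + 1 \<noteq> 0" by (simp add: m_def a_def b_def)
  then have pr: "a = p * (m + 1)" "b = r * (m + 1)" "a * b / (m + 1) = p * r * (m + 1)"
    by (simp_all add: p_def r_def)
  have "(m + 1) * (p + r) = p * (m + 1) + r * (m + 1)" by (simp add: algebra_simps)
  then have "(m + 1) * (p + r) = m" using pr(1,2) m_def by linarith
  then have s: "(m + 1) * (1 - p - r) = 1" by (simp add: algebra_simps)
  have eq: "cell_form i j 1 (- x) (- y) = a * b - b * m * x\<^sup>2 - a * m * y\<^sup>2 - a * b * m * (1 - x - y)\<^sup>2"
    unfolding cell_form_def Let_def a_def[symmetric] b_def[symmetric] m_def[symmetric] by simp
  have "a * b - b * m * x\<^sup>2 - a * m * y\<^sup>2 - a * b * m * (1 - x - y)\<^sup>2 =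
     p * r * (m + 1) - (b * m * u\<^sup>2 + a * m * v\<^sup>2 + a * b * m * (u + v)\<^sup>2)"
    if "(m + 1) * s = 1" "s = 1 - p - r" "x = p + u" "y = r + v" for s u v
    unfolding pr(1,2) using that by algebra
  from this[OF s refl, of "x - p" "y - r"]
  have "a * b - b * m * x\<^sup>2 - a * m * y\<^sup>2 - a * b * m * (1 - x - y)\<^sup>2 =
     p * r * (m + 1) - (b * m * (x - p)\<^sup>2 + a * m * (y - r)\<^sup>2 + a * b * m * ((x - p) + (y - r))\<^sup>2)" by simp
  then show ?thesis unfolding eq pr(3) p_def[symmetric] r_def[symmetric] .
qed

text \<open>The ellipse of the cell touches the axis \<open>fst z = 0\<close> when
  \<open>i = 0\<close>, and likewise for the other coordinate. Hence a positive lower bound for a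
  coordinate needs a positive index, while the last claim still keeps one of the two coordinates
  away from 0.\<close>

lemma cell_box_bounds:
  assumes z: "z \<in> cell_box i j"
  shows "(fst z)\<^sup>2 \<le> 2" "(snd z)\<^sup>2 \<le> 2"
    and "i > 0 \<Longrightarrow> fst z \<ge> 1 / (8 * (real i + real j + 2))"
    and "j > 0 \<Longrightarrow> snd z \<ge> 1 / (8 * (real i + real j + 2))"
    and "fst z \<ge> 1 / (8 * (real i + real j + 2)) \<or> snd z \<ge> 1 / (8 * (real i + real j + 2))"
proof -
  obtain x y where xy: "z = (x, y)" by fastforce
  define a b m where "a = real i + 1" and "b = real j + 1" and "m = a + b"
  have ab: "a \<ge> 1" "b \<ge> 1" "m \<ge> 2" "a \<le> m" "b \<le> m" by (auto simp: a_def b_def m_def)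
  have m': "real i + real j + 2 = m" by (simp add: a_def b_def m_def)
  have "a * b - b * m * x\<^sup>2 - a * m * y\<^sup>2 - a * b * m * (1 - x - y)\<^sup>2 \<ge> - (a * b / (2 * m))"
    using z unfolding cell_box_def cell_form_def Let_def xy m' mem_Collect_eq fst_conv snd_conv
      a_def[symmetric] b_def[symmetric] m_def[symmetric] by simp
  then have le: "b * m * x\<^sup>2 + a * m * y\<^sup>2 + a * b * m * (1 - x - y)\<^sup>2 \<le> a * b * (1 + 1 / (2 * m))"
    by (simp add: algebra_simps)
  then have main: "m * (x\<^sup>2 / a + y\<^sup>2 / b + (1 - x - y)\<^sup>2) \<le> 1 + 1 / (2 * m)"
  proof -
    have "a * b * (m * (x\<^sup>2 / a + y\<^sup>2 / b + (1 - x - y)\<^sup>2)) = b * m * x\<^sup>2 + a * m * y\<^sup>2 + a * b * m * (1 - x - y)\<^sup>2"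
      using ab by (simp add: field_simps)
    then have "a * b * (m * (x\<^sup>2 / a + y\<^sup>2 / b + (1 - x - y)\<^sup>2)) \<le> a * b * (1 + 1 / (2 * m))"
      using le by simp
    then show ?thesis using ab by (simp add: mult_le_cancel_left_pos)
  qed
  have half: "1 / (2 * m) \<le> 1 / 4" using ab by (simp add: field_simps)
  have pos: "x\<^sup>2 / a \<ge> 0" "y\<^sup>2 / b \<ge> 0" "(1 - x - y)\<^sup>2 \<ge> 0" using ab by auto
  have sq: "u\<^sup>2 \<le> 2" if "c \<le> m" "c \<ge> 1" "m * (u\<^sup>2 / c) \<le> 1 + 1 / (2 * m)" for u c
  proof -
    have "u\<^sup>2 \<le> m * (u\<^sup>2 / c)" using that by (simp add: pos_le_divide_eq mult_right_mono mult.commute)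
    then show ?thesis using that half by linarith
  qed
  have "m * (x\<^sup>2 / a) \<le> 1 + 1 / (2 * m)" "m * (y\<^sup>2 / b) \<le> 1 + 1 / (2 * m)"
    using main pos ab by (smt (verit) distrib_left mult_nonneg_nonneg)+
  then show "(fst z)\<^sup>2 \<le> 2" "(snd z)\<^sup>2 \<le> 2" using sq ab by (auto simp: xy)
  \<comment> \<open>By Cauchy-Schwarz the other two squares are at least \<open>(1 - u)\<^sup>2 / (c + 1)\<close>.\<close>
  have key: "u \<ge> 1 / (8 * m)" if "c + 1 \<le> m - 1" "c \<ge> 1" "m * (v\<^sup>2 / c + (1 - u - v)\<^sup>2) \<le> 1 + 1 / (2 * m)"
    for u v c :: real
  proof (rule ccontr)
    assume "\<not> u \<ge> 1 / (8 * m)"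
    then have u: "u < 1 / (8 * m)" by simp
    have "1 / (8 * m) \<le> 1" using ab by simp
    have "(c + 1) * (v\<^sup>2 / c + (1 - u - v)\<^sup>2) = (1 - u)\<^sup>2 + (v - c * (1 - u - v))\<^sup>2 / c"
      using that(2) by (simp add: field_simps power2_eq_square)
    then have "(1 - u)\<^sup>2 \<le> (c + 1) * (v\<^sup>2 / c + (1 - u - v)\<^sup>2)"
      using that(2) by simp
    also have "\<dots> \<le> (m - 1) * (v\<^sup>2 / c + (1 - u - v)\<^sup>2)"
      using that by (intro mult_right_mono) auto
    finally have "m * (1 - u)\<^sup>2 \<le> (m - 1) * (m * (v\<^sup>2 / c + (1 - u - v)\<^sup>2))"
      using ab by (simp add: mult.left_commute)
    also have "\<dots> \<le> (m - 1) * (1 + 1 / (2 * m))"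
      using that ab by (intro mult_left_mono) auto
    finally have 1: "m * (1 - u)\<^sup>2 \<le> (m - 1) * (1 + 1 / (2 * m))" .
    have "m * (1 - 1 / (8 * m))\<^sup>2 \<le> m * (1 - u)\<^sup>2"
      using ab u \<open>1 / (8 * m) \<le> 1\<close> by (intro mult_left_mono power_mono) auto
    then have "m * (1 - 1 / (8 * m))\<^sup>2 \<le> (m - 1) * (1 + 1 / (2 * m))" using 1 by linarith
    then have "m\<^sup>2 * (8 * m - 1)\<^sup>2 \<le> m\<^sup>2 * ((m - 1) * (64 * m + 32))"
      using ab by (simp add: field_simps power2_eq_square)
    then have "(8 * m - 1)\<^sup>2 \<le> (m - 1) * (64 * m + 32)" using ab by simp
    \<comment> \<open>After expansion the inequality says 16 m + 33 \<le> 0.\<close>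
    then show False using ab by (simp add: power2_eq_square algebra_simps)
  qed
  show "fst z \<ge> 1 / (8 * (real i + real j + 2))" if "i > 0"
  proof -
    have "m * (y\<^sup>2 / b + (1 - x - y)\<^sup>2) \<le> 1 + 1 / (2 * m)"
      using main pos ab by (smt (verit) distrib_left mult_nonneg_nonneg)
    then show ?thesis using key[of b y x] that ab unfolding m' by (simp add: xy m_def a_def)
  qed
  show "snd z \<ge> 1 / (8 * (real i + real j + 2))" if "j > 0"
  proof -
    have "m * (x\<^sup>2 / a + (1 - y - x)\<^sup>2) \<le> 1 + 1 / (2 * m)"
      using main pos ab by (smt (verit) distrib_left mult_nonneg_nonneg)
    then show ?thesis using key[of a x y] that ab unfolding m' by (simp add: xy m_def b_def)
  qed
  show "fst z \<ge> 1 / (8 * (real i + real j + 2)) \<or> snd z \<ge> 1 / (8 * (real i + real j + 2))"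
  proof (rule ccontr)
    assume "\<not> ?thesis"
    then have "x < 1 / (8 * m)" "y < 1 / (8 * m)" unfolding m' by (auto simp: xy)
    moreover have "1 / (8 * m) \<le> 1 / 16" using ab by (simp add: field_simps)
    ultimately have "1 - x - y \<ge> 7 / 8" by linarith
    then have "(1 - x - y)\<^sup>2 \<ge> (7 / 8)\<^sup>2" by (intro power_mono) auto
    then have "m * (1 - x - y)\<^sup>2 \<ge> 2 * (7 / 8)\<^sup>2" using ab by (intro mult_mono) auto
    moreover have "m * (1 - x - y)\<^sup>2 \<le> 1 + 1 / (2 * m)"
      using main pos ab by (smt (verit) distrib_left mult_nonneg_nonneg)
    ultimately show False using half by (simp add: power2_eq_square)
  qed
qed

section \<open>Comparing the sizes of the terms at a point\<close>

lemma tri_nonempty [simp]: "tri k \<noteq> {}"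
  by (auto simp: tri_def intro!: exI[of _ 0])

definition term_max :: "nat \<Rightarrow> real \<Rightarrow> real \<times> real \<Rightarrow> real" where
  "term_max k t z = Max ((\<lambda>q. \<bar>term_at t z q\<bar>) ` tri k)"

lemma term_le_max: "q \<in> tri k \<Longrightarrow> \<bar>term_at t z q\<bar> \<le> term_max k t z"
  by (simp add: term_max_def)

lemma term_max_attained: obtains q where "q \<in> tri k" "\<bar>term_at t z q\<bar> = term_max k t z"
proof -
  have "term_max k t z \<in> (\<lambda>q. \<bar>term_at t z q\<bar>) ` tri k"
    unfolding term_max_def by (intro Max_in) auto
  then show thesis using that by auto
qed

text \<open>The term at (0, 0) is the constant 1, even on the coordinate axes.\<close>

lemma term_max_pos: "term_max k t z > 0"
proof -
  have "\<bar>term_at t z (0, 0)\<bar> \<le> term_max k t z"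
    by (rule term_le_max) (simp add: tri_def)
  then show ?thesis by (simp add: term_at_def ht_def)
qed

lemma term_mult_le:
  assumes "0 \<le> t" "t \<le> 1" "fst q + fst q' = fst r + fst r'" "snd q + snd q' = snd r + snd r'"
    and "ht r + ht r' + 2 \<le> ht q + ht q'"
  shows "\<bar>term_at t z q\<bar> * \<bar>term_at t z q'\<bar> \<le> t\<^sup>2 * (\<bar>term_at t z r\<bar> * \<bar>term_at t z r'\<bar>)"
proof -
  have eq: "\<bar>term_at t z p\<bar> * \<bar>term_at t z p'\<bar> =
      t ^ (ht p + ht p') * (\<bar>fst z\<bar> ^ (fst p + fst p') * \<bar>snd z\<bar> ^ (snd p + snd p'))" for p p'
    using assms(1) by (simp add: term_at_def abs_mult power_abs power_add algebra_simps)
  have "t ^ (ht q + ht q') \<le> t ^ (ht r + ht r' + 2)"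
    using assms by (intro power_decreasing) auto
  then show ?thesis
    unfolding eq assms(3,4) mult.assoc[symmetric]
    by (intro mult_right_mono) (auto simp: power_add power2_eq_square algebra_simps)
qed

text \<open>Equality or adjacency in the triangulation: of the two diagonals of a unit square, the
  one in direction (1, 1) is not an edge.\<close>

definition near :: "nat \<times> nat \<Rightarrow> nat \<times> nat \<Rightarrow> bool" where
  "near q r \<longleftrightarrow> fst q \<le> fst r + 1 \<and> fst r \<le> fst q + 1 \<and> snd q \<le> snd r + 1 \<and> snd r \<le> snd q + 1 \<and>
     r \<noteq> (fst q + 1, snd q + 1) \<and> q \<noteq> (fst r + 1, snd r + 1)"

text \<open>If two lattice points are not adjacent, they can be moved towards each other, which decreases the
  sum of their heights: two non-adjacent terms cannot both be large.\<close>

lemma large_terms_near: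
  assumes t: "0 < t" "t \<le> 1" and qr: "q \<in> tri k" "q' \<in> tri k"
    and large: "\<bar>term_at t z q\<bar> > t * term_max k t z" "\<bar>term_at t z q'\<bar> > t * term_max k t z"
  shows "near q q'"
proof -
  let ?M = "term_max k t z"
  \<comment> \<open>An exchange that keeps the sum of the exponents and lowers the total height by 2
    bounds the product of the two terms by \<open>t\<^sup>2 * ?M\<^sup>2\<close>, whereas two large
    terms have a larger product.\<close>
  have no: False
    if "r \<in> tri k" "r' \<in> tri k" "fst q + fst q' = fst r + fst r'" "snd q + snd q' = snd r + snd r'"
      "ht r + ht r' + 2 \<le> ht q + ht q'" for r r'
  proof -
    have "(t * ?M) * (t * ?M) < \<bar>term_at t z q\<bar> * \<bar>term_at t z q'\<bar>"
      using large t term_max_pos[of k t z] by (intro mult_strict_mono') auto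
    also have "\<dots> \<le> t\<^sup>2 * (\<bar>term_at t z r\<bar> * \<bar>term_at t z r'\<bar>)"
      using t that by (intro term_mult_le) auto
    also have "\<dots> \<le> t\<^sup>2 * (?M * ?M)"
      using t that term_max_pos[of k t z] by (intro mult_left_mono mult_mono term_le_max) auto
    finally show False by (simp add: power2_eq_square)
  qed
  have sym: "near q q' \<longleftrightarrow> near q' q" by (auto simp: near_def)
  \<comment> \<open>Difference vector with nonnegative entries: both points make a unit step towards
    each other parallel to an axis. The new points lie coordinatewise between the old ones, hence in
    the triangle.\<close>
  have A: "near p p'" if "p = (i, j)" "p' = (i + u, j + v)" "{p, p'} = {q, q'}" for p p' i j u v
  proof (rule ccontr)
    assume n: "\<not> near p p'"
    have S: "p \<in> tri k" "p' \<in> tri k" using that(3) qr by auto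
    have "\<not> (u = 0 \<and> v = 0)" "\<not> (u = 1 \<and> v = 0)" "\<not> (u = 0 \<and> v = 1)"
      using n that(1,2) by (auto simp: near_def)
    then consider "u \<ge> 1" "u \<ge> 2 \<or> v \<ge> 1" | "u = 0" "v \<ge> 2" by linarith
    then show False
    proof cases
      case 1
      then obtain u' where u': "u = Suc u'" by (cases u) auto
      have "ht (i + 1, j) + ht (i + u', j + v) + 2 \<le> ht p + ht p'"
      proof -
        have "6 * u' + 2 * v \<ge> 2" using 1 u' by linarith
        then show ?thesis by (simp add: u' that(1,2) ht_def power2_eq_square algebra_simps)
      qed
      then show False using no[of "(i + 1, j)" "(i + u', j + v)"] S that u'
        by (auto simp: tri_def doubleton_eq_iff)
    next
      case 2
      then obtain v' where v': "v = Suc (Suc v')" by (metis add_2_eq_Suc le_Suc_ex)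
      have "ht (i, j + 1) + ht (i, j + 1 + v') + 2 \<le> ht p + ht p'"
        using 2 by (simp add: v' that(1,2) ht_def power2_eq_square algebra_simps)
      then show False using no[of "(i, j + 1)" "(i, j + 1 + v')"] S that 2 v'
        by (auto simp: tri_def doubleton_eq_iff)
    qed
  qed
  \<comment> \<open>Difference vector with entries of opposite sign: the inward step is along (1,
    -1), which preserves i + j for each of the points.\<close>
  have B: "near p p'" if "p = (i, j + v)" "p' = (i + u, j)" "{p, p'} = {q, q'}" and pos: "u > 0" "v > 0" for p p' i j u v
  proof (rule ccontr)
    assume n: "\<not> near p p'"
    have S: "p \<in> tri k" "p' \<in> tri k" using that(3) qr by auto
    obtain u' v' where uv: "u = Suc u'" "v = Suc v'" using pos by (cases u; cases v) auto
    then have "u' \<noteq> 0 \<or> v' \<noteq> 0" using n that(1,2) by (auto simp: near_def)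
    then have "ht (i + 1, j + v') + ht (i + u', j + 1) + 2 \<le> ht p + ht p'"
    proof -
      have "4 * u' + 4 * v' \<ge> 2" using \<open>u' \<noteq> 0 \<or> v' \<noteq> 0\<close> by linarith
      then show ?thesis by (simp add: uv that(1,2) ht_def power2_eq_square algebra_simps)
    qed
    then show False using no[of "(i + 1, j + v')" "(i + u', j + 1)"] S that uv
      by (auto simp: tri_def doubleton_eq_iff)
  qed
  obtain i j i' j' where q: "q = (i, j)" "q' = (i', j')" by fastforce
  consider "i \<le> i'" "j \<le> j'" | "i' \<le> i" "j' \<le> j" | "i < i'" "j' < j" | "i' < i" "j < j'" by linarith
  then show ?thesis
  proof cases
    case 1
    then show ?thesis using A[of q i j q' "i' - i" "j' - j"] q by simp
  next
    case 2
    then show ?thesis using A[of q' i' j' q "i - i'" "j - j'"] q sym by (simp add: insert_commute)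
  next
    case 3
    then show ?thesis using B[of q i j' "j - j'" q' "i' - i"] q by simp
  next
    case 4
    then show ?thesis using B[of q' i' j "j' - j" q "i - i'"] q sym by (simp add: insert_commute)
  qed
qed

definition verts :: "bool \<times> nat \<times> nat \<Rightarrow> (nat \<times> nat) set" where
  "verts c = (case c of (up, i, j) \<Rightarrow>
     if up then {(i, j), (i + 1, j), (i, j + 1)} else {(i + 1, j + 1), (i, j + 1), (i + 1, j)})"

text \<open>A downward triangle is indexed by the corner \<open>(i, j)\<close> of the parallelogram that is not one of its
  vertices.\<close>

definition cells :: "nat \<Rightarrow> (bool \<times> nat \<times> nat) set" where
  "cells k = {(up, i, j). if up then i + j + 1 \<le> k else i + j + 2 \<le> k}"

text \<open>With \<open>a\<close> and \<open>b\<close> the least coordinates, attained perhaps at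
  different points, adjacency confines \<open>L\<close> to one unit square, and \<open>L\<close>
  cannot contain both ends of its long diagonal.\<close>

lemma clique_in_cell:
  assumes "k \<ge> 1" "L \<subseteq> tri k" "L \<noteq> {}" "\<And>q r. \<lbrakk>q \<in> L; r \<in> L\<rbrakk> \<Longrightarrow> near q r"
  shows "\<exists>c\<in>cells k. L \<subseteq> verts c"
proof -
  have fin: "finite L" by (rule finite_subset[OF assms(2)]) simp
  define a b where "a = Min (fst ` L)" and "b = Min (snd ` L)"
  have "a \<in> fst ` L" "b \<in> snd ` L" unfolding a_def b_def using fin assms(3) by (auto intro!: Min_in)
  then obtain j i where aj: "(a, j) \<in> L" and ib: "(i, b) \<in> L" by auto
  have ge: "a \<le> fst q" "b \<le> snd q" if "q \<in> L" for q
    unfolding a_def b_def using fin that by auto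
  have le: "fst q \<le> a + 1" "snd q \<le> b + 1" if "q \<in> L" for q
    using assms(4)[OF that aj] assms(4)[OF that ib] by (auto simp: near_def)
  have sq: "L \<subseteq> {(a, b), (a + 1, b), (a, b + 1), (a + 1, b + 1)}"
  proof
    fix q assume "q \<in> L"
    then show "q \<in> {(a, b), (a + 1, b), (a, b + 1), (a + 1, b + 1)}"
      using ge[of q] le[of q] by (cases q) auto
  qed
  show ?thesis
  proof (cases "(a + 1, b + 1) \<in> L")
    case True
    then have "(a, b) \<notin> L" using assms(4)[OF True, of "(a, b)"] by (auto simp: near_def)
    then have "L \<subseteq> verts (False, a, b)" using sq by (auto simp: verts_def)
    moreover have "(False, a, b) \<in> cells k" using True assms(2) by (auto simp: cells_def tri_def)
    ultimately show ?thesis by blast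
  next
    case False
    then have L: "L \<subseteq> verts (True, a, b)" using sq by (auto simp: verts_def)
    show ?thesis
    proof (cases "a + b + 1 \<le> k")
      case True
      then show ?thesis using L by (intro bexI[of _ "(True, a, b)"]) (auto simp: cells_def)
    next
      \<comment> \<open>The upward triangle at \<open>(a, b)\<close> would stick out over the
        hypotenuse. Then \<open>L\<close> is the single point \<open>(a, b)\<close>, which is also a
        vertex of an upward triangle one step to the left or below.\<close>
      case False
      have "a + b \<le> fst (a, j) + snd (a, j)" using ge(2)[OF aj] by simp
      also have "\<dots> \<le> k" using aj assms(2) by (auto simp: tri_def)
      finally have "a + b \<le> k" .
      then have L: "L \<subseteq> {(a, b)}" "a + b = k"
        using L False assms(2) by (auto simp: verts_def tri_def)
      show ?thesis
      proof (cases "a > 0")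
        case True
        then show ?thesis using L by (intro bexI[of _ "(True, a - 1, b)"]) (auto simp: cells_def verts_def)
      next
        case False
        then show ?thesis using L assms(1)
          by (intro bexI[of _ "(True, a, b - 1)"]) (auto simp: cells_def verts_def)
      qed
    qed
  qed
qed

definition dominated :: "nat \<Rightarrow> bool \<times> nat \<times> nat \<Rightarrow> real \<Rightarrow> real \<times> real \<Rightarrow> bool" where
  "dominated k c t z \<longleftrightarrow> (\<forall>q\<in>tri k - verts c. \<bar>term_at t z q\<bar> \<le> t * term_max k t z)"

text \<open>The terms above the threshold are pairwise adjacent and include the largest one, so they
  form a nonempty clique.\<close>

lemma ex_dominated:
  assumes "k \<ge> 1" "0 < t" "t < 1"
  shows "\<exists>c\<in>cells k. dominated k c t z"
proof -
  let ?L = "{q \<in> tri k. \<bar>term_at t z q\<bar> > t * term_max k t z}"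
  obtain q where q: "q \<in> tri k" "\<bar>term_at t z q\<bar> = term_max k t z" by (rule term_max_attained)
  then have "q \<in> ?L" using assms term_max_pos[of k t z] by simp
  then have "?L \<noteq> {}" by blast
  moreover have "near q r" if "q \<in> ?L" "r \<in> ?L" for q r
    using that assms by (intro large_terms_near[of t q k r z]) auto
  ultimately have "\<exists>c\<in>cells k. ?L \<subseteq> verts c"
    by (intro clique_in_cell[OF assms(1)]) auto
  then obtain c where c: "c \<in> cells k" "?L \<subseteq> verts c" ..
  have "\<bar>term_at t z q\<bar> \<le> t * term_max k t z" if "q \<in> tri k - verts c" for q
  proof (rule ccontr)
    assume "\<not> ?thesis"
    then have "q \<in> ?L" using that by simp
    then show False using c(2) that by blast
  qed
  then have "dominated k c t z" unfolding dominated_def by blast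
  then show ?thesis using c(1) by blast
qed

text \<open>The excess of \<open>ht\<close> over the affine function that agrees with it at (0, 0),
  (1, 0) and (0, 1). As \<open>ht\<close> is quadratic, shifted arguments give the excess over every
  upward triangle.\<close>

definition gam :: "int \<Rightarrow> int \<Rightarrow> int" where
  "gam u v = 3 * u\<^sup>2 + 2 * u * v + 3 * v\<^sup>2 - 3 * u - 3 * v"

text \<open>The value at (1, 1) is 2. The gap up to 4 ensures that after division by t^2 every
  further term still has a factor t^2.\<close>

lemma gam_ge:
  assumes "(u, v) \<notin> {(0, 0), (1, 0), (0, 1), (1, 1)}"
  shows "gam u v \<ge> 4"
proof -
  have eq: "gam u v = (u + v)\<^sup>2 + u * (2 * u - 3) + v * (2 * v - 3)"
    by (simp add: gam_def power2_eq_square algebra_simps)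
  have a: "w * (2 * w - 3) \<ge> 5" if "w \<le> -1" for w :: int
    using mult_mono[of 1 "- w" 5 "3 - 2 * w"] that by (simp add: algebra_simps)
  have b: "w * (2 * w - 3) \<ge> 2" if "w \<ge> 2" for w :: int
    using mult_mono[of 2 w 1 "2 * w - 3"] that by simp
  have c: "w \<le> -1 \<or> w = 0 \<or> w = 1 \<or> w \<ge> 2" for w :: int by linarith
  have low: "w * (2 * w - 3) \<ge> -1" for w :: int
    using c[of w] a[of w] b[of w] by auto
  have d: "w\<^sup>2 \<ge> 4" if "w \<ge> 2" for w :: int
    using power_mono[of 2 w 2] that by simp
  have sq: "(u + v)\<^sup>2 \<ge> 0" by simp
  consider "u \<le> -1" | "v \<le> -1" | "u \<ge> 2" "v \<ge> 2" | "u = 0" "v \<ge> 2" | "u = 1" "v \<ge> 2"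
    | "u \<ge> 2" "v = 0" | "u \<ge> 2" "v = 1"
    using c[of u] c[of v] assms by auto
  then show ?thesis
  proof cases
    case 1 then show ?thesis unfolding eq using a[of u] low[of v] sq by linarith
  next
    case 2 then show ?thesis unfolding eq using a[of v] low[of u] sq by linarith
  next
    case 3 then show ?thesis unfolding eq using b[of v] b[of u] sq by linarith
  next
    case 4 then show ?thesis unfolding eq using b[of v] d[of v] by simp
  next
    case 5 then show ?thesis unfolding eq using b[of v] d[of "1 + v"] by simp
  next
    case 6 then show ?thesis unfolding eq using b[of u] d[of u] by simp
  next
    case 7 then show ?thesis unfolding eq using b[of u] d[of "u + 1"] by simp
  qed
qed

lemma gam_simps [simp]: "gam 0 0 = 0" "gam 1 0 = 0" "gam 0 1 = 0" "gam 1 1 = 2"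
  by (simp_all add: gam_def)

lemma gam_nonneg: "gam u v \<ge> 0"
  by (cases "(u, v) \<in> {(0, 0), (1, 0), (0, 1), (1, 1)}") (use gam_ge[of u v] in auto)

definition gam_up :: "nat \<Rightarrow> nat \<Rightarrow> nat \<times> nat \<Rightarrow> nat" where
  "gam_up i j q = nat (gam (int (fst q) - int i) (int (snd q) - int j))"

text \<open>The point reflection at the centre of the parallelogram turns the downward triangle into
  an upward one and leaves the quadratic part of the height unchanged, so \<open>gam\<close> serves
  again; the missing corner \<open>(i, j)\<close> plays the part of (1, 1).\<close>

definition gam_down :: "nat \<Rightarrow> nat \<Rightarrow> nat \<times> nat \<Rightarrow> nat" where
  "gam_down i j q = nat (gam (int i + 1 - int (fst q)) (int j + 1 - int (snd q)))"

lemma gam_up_vert: "q \<in> verts (True, i, j) \<Longrightarrow> gam_up i j q = 0"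
  by (auto simp: verts_def gam_up_def)

lemma gam_up_ge: "q \<notin> verts (True, i, j) \<Longrightarrow> gam_up i j q \<ge> 2"
proof -
  assume q: "q \<notin> verts (True, i, j)"
  obtain a b where ab: "q = (a, b)" by fastforce
  show ?thesis
  proof (cases "q = (i + 1, j + 1)")
    case False
    then have "gam (int a - int i) (int b - int j) \<ge> 4"
      using q by (intro gam_ge) (auto simp: verts_def ab)
    then show ?thesis by (simp add: gam_up_def ab)
  qed (simp add: gam_up_def)
qed

lemma gam_down_vert: "q \<in> verts (False, i, j) \<Longrightarrow> gam_down i j q = 0"
  by (auto simp: verts_def gam_down_def)

lemma gam_down_corner: "gam_down i j (i, j) = 2"
  by (simp add: gam_down_def)

lemma gam_down_ge: "q \<notin> verts (False, i, j) \<Longrightarrow> q \<noteq> (i, j) \<Longrightarrow> gam_down i j q \<ge> 4"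
proof -
  assume q: "q \<notin> verts (False, i, j)" "q \<noteq> (i, j)"
  obtain a b where ab: "q = (a, b)" by fastforce
  have "gam (int i + 1 - int a) (int j + 1 - int b) \<ge> 4"
    using q by (intro gam_ge) (auto simp: verts_def ab)
  then show ?thesis by (simp add: gam_down_def ab)
qed

text \<open>The coefficients of \<open>fst q\<close> and \<open>snd q\<close> are the height
  differences along the two sides from \<open>(i, j)\<close>. They become the powers of
  \<open>t\<close> that rescale the coordinates. Constants stand on the side that avoids subtraction
  of naturals.\<close>

lemma ht_gam_up:
  "ht q + (3 * i\<^sup>2 + 2 * i * j + 3 * j\<^sup>2 + 3 * i + 3 * j) =
     gam_up i j q + (6 * i + 2 * j + 3) * fst q + (2 * i + 6 * j + 3) * snd q" (is "?l = ?r")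
proof -
  have "int ?l = int ?r"
    by (simp add: gam_up_def gam_nonneg) (simp add: gam_def ht_def power2_eq_square algebra_simps)
  then show ?thesis by (simp only: of_nat_eq_iff)
qed

lemma ht_gam_down:
  "ht q + (3 * i\<^sup>2 + 2 * i * j + 3 * j\<^sup>2 + 5 * i + 5 * j + 2) =
     gam_down i j q + (6 * i + 2 * j + 5) * fst q + (2 * i + 6 * j + 5) * snd q" (is "?l = ?r")
proof -
  have "int ?l = int ?r"
    by (simp add: gam_down_def gam_nonneg) (simp add: gam_def ht_def power2_eq_square algebra_simps)
  then show ?thesis by (simp only: of_nat_eq_iff)
qed

section \<open>Upward triangles\<close>

lemma eventually_small: "\<eta> > 0 \<Longrightarrow> \<forall>\<^sub>F t in at_right (0::real). C * t \<le> \<eta>"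
proof -
  assume "\<eta> > 0"
  have "((\<lambda>t. C * t) \<longlongrightarrow> C * 0) (at_right (0::real))"
    by (intro tendsto_intros)
  then have "\<forall>\<^sub>F t in at_right (0::real). C * t < \<eta>"
    using \<open>\<eta> > 0\<close> by (intro order_tendstoD) auto
  then show ?thesis by eventually_elim simp
qed

lemma eventually_less_right: "\<eta> > 0 \<Longrightarrow> \<forall>\<^sub>F t in at_right (0::real). 0 < t \<and> t < \<eta>"
  using eventually_at_right_real[of 0 \<eta>] by simp

text \<open>Compactness and connectedness pass to the continuous image. If \<open>P\<close> had
  derivative zero at a zero \<open>\<Phi> w\<close>, then chain and product rule would give
  \<open>g = (P \<circ> \<Phi>) * s\<close> derivative zero at \<open>w\<close>, so
  \<open>\<Phi>\<close> need not be invertible.\<close>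

lemma oval_transport:
  fixes P g s :: "real \<times> real \<Rightarrow> real" and \<Phi> :: "real \<times> real \<Rightarrow> real \<times> real"
  assumes Z: "compact {w \<in> W. g w = 0}" "connected {w \<in> W. g w = 0}" "{w \<in> W. g w = 0} \<noteq> {}"
    and nz: "\<And>w. \<lbrakk>w \<in> W; g w = 0\<rbrakk> \<Longrightarrow> \<not> (g has_derivative (\<lambda>_. 0)) (at w)"
    and U: "open U" "W \<subseteq> U"
    and g: "\<And>w. w \<in> U \<Longrightarrow> g w = P (\<Phi> w) * s w" "\<And>w. w \<in> U \<Longrightarrow> s w \<noteq> 0"
    and d: "\<And>w. w \<in> U \<Longrightarrow> \<Phi> differentiable (at w)" "\<And>w. w \<in> U \<Longrightarrow> s differentiable (at w)"
  shows "compact {z \<in> \<Phi> ` W. P z = 0} \<and> connected {z \<in> \<Phi> ` W. P z = 0} \<and> {z \<in> \<Phi> ` W. P z = 0} \<noteq> {} \<and>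
    (\<forall>z \<in> \<Phi> ` W. P z = 0 \<longrightarrow> \<not> (P has_derivative (\<lambda>_. 0)) (at z))"
proof -
  have iff: "g w = 0 \<longleftrightarrow> P (\<Phi> w) = 0" if "w \<in> W" for w
    using g[of w] that U by auto
  then have eq: "{z \<in> \<Phi> ` W. P z = 0} = \<Phi> ` {w \<in> W. g w = 0}"
    by auto
  have cont: "continuous_on {w \<in> W. g w = 0} \<Phi>"
    using U d(1) by (intro continuous_at_imp_continuous_on) (auto intro!: differentiable_imp_continuous_within)
  have "\<not> (P has_derivative (\<lambda>_. 0)) (at z)" if "z \<in> \<Phi> ` W" "P z = 0" for z
  proof
    assume P: "(P has_derivative (\<lambda>_. 0)) (at z)"
    from that(1) obtain w where w: "w \<in> W" "z = \<Phi> w" by blast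
    then have wU: "w \<in> U" using U by auto
    obtain \<Phi>' s' where "(\<Phi> has_derivative \<Phi>') (at w)" and s': "(s has_derivative s') (at w)"
      using d[OF wU] by (auto simp: differentiable_def)
    then have "((\<lambda>w. P (\<Phi> w)) has_derivative (\<lambda>h. 0)) (at w)"
      using has_derivative_compose[of \<Phi> \<Phi>' w UNIV P "\<lambda>_. 0"] P w by simp
    then have "((\<lambda>w. P (\<Phi> w) * s w) has_derivative (\<lambda>h. P (\<Phi> w) * s' h + 0 * s w)) (at w)"
      by (rule has_derivative_mult[OF _ s'])
    then have "((\<lambda>w. P (\<Phi> w) * s w) has_derivative (\<lambda>h. 0)) (at w)"
      using that w by simp
    then have "(g has_derivative (\<lambda>_. 0)) (at w)"
      by (rule has_derivative_transform_within_open[OF _ U(1) wU]) (use g in auto)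
    then show False using nz w iff that by blast
  qed
  then show ?thesis
    unfolding eq using Z cont by (auto intro: compact_continuous_image connected_continuous_image)
qed

definition hess_patch :: "nat \<Rightarrow> real \<Rightarrow> real \<times> real \<Rightarrow> real" where
  "hess_patch k t z = hess_form (tri k) (term_at t z)"

lemma C1_family_hess_form:
  assumes "\<And>q. q \<in> S \<Longrightarrow> C1_family T W (\<lambda>t w. f t w q)"
  shows "C1_family T W (\<lambda>t w. hess_form S (f t w))"
  unfolding hess_form_def
  by (intro C1_family_diff C1_family_mult C1_family_power C1_family_sum C1_family_const assms)

lemma oval_cell:
  assumes "T > 0" "C1_family T (cell_box i j) g" "open U" "cell_box i j \<subseteq> U"
    and "\<And>w. w \<in> U \<Longrightarrow> g 0 w = cell_form i j 1 (- fst w) (- snd w)"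
  shows "\<forall>\<^sub>F t in at_right 0. compact {w \<in> cell_box i j. g t w = 0} \<and> connected {w \<in> cell_box i j. g t w = 0} \<and>
           {w \<in> cell_box i j. g t w = 0} \<noteq> {} \<and>
           (\<forall>w \<in> cell_box i j. g t w = 0 \<longrightarrow> \<not> (g t has_derivative (\<lambda>_. 0)) (at w))"
proof -
  define a b m where "a = real i + 1" and "b = real j + 1" and "m = a + b"
  have pos: "a > 0" "b > 0" "m > 0" by (auto simp: a_def b_def m_def)
  define z0 where "z0 = (a / (m + 1), b / (m + 1))"
  define \<kappa> \<theta> where "\<kappa> = a * b / (m + 1)" and "\<theta> = a * b / (2 * m)"
  have eq: "cell_form i j 1 (- fst z) (- snd z) = \<kappa> - (b * m * (fst (z - z0))\<^sup>2 + a * m * (snd (z - z0))\<^sup>2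
      + a * b * m * (fst (z - z0) + snd (z - z0))\<^sup>2)" for z
    unfolding cell_form_centre \<kappa>_def z0_def a_def b_def m_def by simp
  have m: "real i + real j + 2 = m" by (simp add: a_def b_def m_def)
  have box: "cell_box i j = {z. b * m * (fst (z - z0))\<^sup>2 + a * m * (snd (z - z0))\<^sup>2
      + a * b * m * (fst (z - z0) + snd (z - z0))\<^sup>2 \<le> \<kappa> + \<theta>}"
    unfolding cell_box_def eq m a_def[symmetric] b_def[symmetric] \<theta>_def[symmetric] by auto
  have "\<kappa> > 0" "\<theta> > 0" using pos by (auto simp: \<kappa>_def \<theta>_def)
  then show ?thesis
    using pos assms unfolding box eq by (intro oval_family) auto
qed

text \<open>The powers of \<open>t\<close> cancel the slopes of \<open>ht\<close> on the triangle,
  so that in the coordinates \<open>w\<close> its three terms have the same order in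
  \<open>t\<close>.\<close>

definition up_map :: "nat \<Rightarrow> nat \<Rightarrow> real \<Rightarrow> real \<times> real \<Rightarrow> real \<times> real" where
  "up_map i j t w = (fst w / t ^ (6 * i + 2 * j + 3), snd w / t ^ (2 * i + 6 * j + 3))"

text \<open>The quotients of all terms by the term at \<open>(i, j)\<close>, in the chart. They are
  written with quotients of powers so that for \<open>i = 0\<close> or \<open>j = 0\<close> points
  on the corresponding axis cause no division by zero.\<close>

definition up_terms :: "nat \<Rightarrow> nat \<Rightarrow> real \<Rightarrow> real \<times> real \<Rightarrow> nat \<times> nat \<Rightarrow> real" where
  "up_terms i j t w q = (-1) ^ (i + j + fst q + snd q) * t ^ gam_up i j q *
     (fst w ^ fst q / fst w ^ i) * (snd w ^ snd q / snd w ^ j)"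

text \<open>Nonvanishing is asked of the powers and not of the coordinates: for \<open>i = 0\<close>
  the axis, which the ellipse touches, must belong to the domain.\<close>

definition up_dom :: "nat \<Rightarrow> nat \<Rightarrow> (real \<times> real) set" where
  "up_dom i j = {w. fst w ^ i \<noteq> 0 \<and> snd w ^ j \<noteq> 0}"

lemma cell_box_up_dom: "cell_box i j \<subseteq> up_dom i j"
proof
  fix w assume w: "w \<in> cell_box i j"
  have pos: "1 / (8 * (real i + real j + 2)) > 0" by simp
  have "i > 0 \<Longrightarrow> fst w > 0" "j > 0 \<Longrightarrow> snd w > 0"
    using less_le_trans[OF pos] cell_box_bounds(3,4)[OF w] by blast+
  then show "w \<in> up_dom i j"
    by (cases "i = 0"; cases "j = 0") (auto simp: up_dom_def)
qed

lemma open_up_dom: "open (up_dom i j)"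
  unfolding up_dom_def by (intro open_Collect_conj open_Collect_neq continuous_intros)

lemma term_at_up_map:
  assumes "t > 0" "w \<in> up_dom i j"
  shows "term_at t (up_map i j t w) q =
    ((-1) ^ (i + j) * fst w ^ i * snd w ^ j / t ^ (3 * i\<^sup>2 + 2 * i * j + 3 * j\<^sup>2 + 3 * i + 3 * j)) * up_terms i j t w q"
proof -
  define C0 where "C0 = 3 * i\<^sup>2 + 2 * i * j + 3 * j\<^sup>2 + 3 * i + 3 * j"
  define e where "e = (6 * i + 2 * j + 3) * fst q + (2 * i + 6 * j + 3) * snd q"
  have w: "fst w ^ i \<noteq> 0" "snd w ^ j \<noteq> 0" using assms by (auto simp: up_dom_def)
  have "t ^ ht q * t ^ C0 = t ^ gam_up i j q * t ^ e"
    unfolding power_add[symmetric] C0_def e_def using ht_gam_up[of q i j] by (simp only: add.assoc)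
  then have e: "t ^ ht q / t ^ e = t ^ gam_up i j q / t ^ C0"
    using assms by (simp add: field_simps)
  have "term_at t (up_map i j t w) q = (-1) ^ (fst q + snd q) * (t ^ ht q / t ^ e) * fst w ^ fst q * snd w ^ snd q"
    by (simp add: term_at_def up_map_def e_def power_divide power_mult power_add)
  also have "\<dots> = (-1) ^ (fst q + snd q) * (t ^ gam_up i j q / t ^ C0) * fst w ^ fst q * snd w ^ snd q"
    unfolding e ..
  also have "\<dots> = ((-1) ^ (i + j) * fst w ^ i * snd w ^ j / t ^ C0) * up_terms i j t w q"
  proof -
    have "e' * (g / d) * x * y = (e * a * b / d) * ((e * e') * g * (x / a) * (y / b))"
      if "e * e = 1" "a \<noteq> 0" "b \<noteq> 0" for e e' g d x y a b :: real
      using that by simp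
    moreover have "(-1) ^ (i + j) * (-1) ^ (i + j) = (1::real)" by (simp flip: power_mult_distrib)
    moreover have "(-1) ^ (i + j + fst q + snd q) = (-1) ^ (i + j) * ((-1) ^ (fst q + snd q) :: real)"
      by (simp add: power_add)
    ultimately show ?thesis unfolding up_terms_def using w by metis
  qed
  finally show ?thesis unfolding C0_def .
qed

lemma hess_patch_up_map:
  assumes "t > 0" "w \<in> up_dom i j"
  shows "hess_form (tri k) (up_terms i j t w) = hess_patch k t (up_map i j t w) *
    (t ^ (3 * i\<^sup>2 + 2 * i * j + 3 * j\<^sup>2 + 3 * i + 3 * j) / (fst w ^ i * snd w ^ j))\<^sup>2"
proof -
  have "hess_patch k t (up_map i j t w) =
    ((-1) ^ (i + j) * fst w ^ i * snd w ^ j / t ^ (3 * i\<^sup>2 + 2 * i * j + 3 * j\<^sup>2 + 3 * i + 3 * j))\<^sup>2 *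
     hess_form (tri k) (up_terms i j t w)"
    unfolding hess_patch_def hess_form_scale[symmetric]
    by (rule hess_form_cong) (simp add: term_at_up_map assms)
  moreover have "((-1) ^ (i + j))\<^sup>2 = (1::real)" by (simp flip: power_mult power_mult_distrib)
  moreover have "fst w ^ i \<noteq> 0" "snd w ^ j \<noteq> 0" using assms by (auto simp: up_dom_def)
  moreover have "H = (e * a * b / d)\<^sup>2 * H * (d / (a * b))\<^sup>2"
    if "e\<^sup>2 = 1" "a \<noteq> 0" "b \<noteq> 0" "d \<noteq> 0" for H a b d e :: real
    using that by (simp add: power_mult_distrib power_divide)
  ultimately show ?thesis using assms(1) by simp
qed

text \<open>By \<open>0 ^ 0 = 1\<close> the vertices survive at t = 0, while every other term has a
  positive power of \<open>t\<close>.\<close>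

lemma up_terms_0:
  assumes "i + j + 1 \<le> k" "w \<in> up_dom i j"
  shows "hess_form (tri k) (up_terms i j 0 w) = cell_form i j 1 (- fst w) (- snd w)"
proof -
  have w: "fst w ^ i \<noteq> 0" "snd w ^ j \<noteq> 0" using assms by (auto simp: up_dom_def)
  have sgn: "(-1 :: real) ^ (i + j + i + j) = 1" by (rule neg_one_even_power) presburger
  have "up_terms i j 0 w q = 0" if "q \<in> tri k - {(i, j), (i + 1, j), (i, j + 1)}" for q
    using gam_up_ge[of q i j] that by (simp add: up_terms_def verts_def)
  then have "hess_form (tri k) (up_terms i j 0 w) = cell_form i j (up_terms i j 0 w (i, j))
      (up_terms i j 0 w (i + 1, j)) (up_terms i j 0 w (i, j + 1))"
    using assms(1) by (intro hess_form_up)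
  also have "\<dots> = cell_form i j 1 (- fst w) (- snd w)"
    using w sgn gam_up_vert[of "(i, j)" i j] gam_up_vert[of "(i + 1, j)" i j] gam_up_vert[of "(i, j + 1)" i j]
    by (simp add: up_terms_def verts_def del: power_eq_0_iff)
  finally show ?thesis .
qed

lemma up_oval:
  assumes "i + j + 1 \<le> k"
  shows "\<forall>\<^sub>F t in at_right 0.
    (let R = up_map i j t ` cell_box i j; Z = {z \<in> R. hess_patch k t z = 0} in
       compact Z \<and> connected Z \<and> Z \<noteq> {} \<and> (\<forall>z\<in>Z. \<not> (hess_patch k t has_derivative (\<lambda>_. 0)) (at z)))"
proof -
  let ?g = "\<lambda>t w. hess_form (tri k) (up_terms i j t w)"
  have "C1_family 1 (cell_box i j) ?g"
    unfolding up_terms_def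
    by (intro C1_family_hess_form C1_family_mult C1_family_divide C1_family_power C1_family_const C1_family_param
         C1_family_fst C1_family_snd) (use cell_box_up_dom[of i j] in \<open>auto simp: up_dom_def\<close>)
  then have "\<forall>\<^sub>F t in at_right 0. compact {w \<in> cell_box i j. ?g t w = 0} \<and> connected {w \<in> cell_box i j. ?g t w = 0} \<and>
           {w \<in> cell_box i j. ?g t w = 0} \<noteq> {} \<and>
           (\<forall>w \<in> cell_box i j. ?g t w = 0 \<longrightarrow> \<not> (?g t has_derivative (\<lambda>_. 0)) (at w))"
    by (intro oval_cell[OF _ _ open_up_dom cell_box_up_dom] up_terms_0 assms) auto
  moreover have "\<forall>\<^sub>F t in at_right (0::real). 0 < t \<and> t < 1"
    by (rule eventually_less_right) simp
  ultimately show ?thesis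
  proof eventually_elim
    case (elim t)
    let ?s = "\<lambda>w. (t ^ (3 * i\<^sup>2 + 2 * i * j + 3 * j\<^sup>2 + 3 * i + 3 * j) / (fst w ^ i * snd w ^ j))\<^sup>2"
    have "compact {z \<in> up_map i j t ` cell_box i j. hess_patch k t z = 0} \<and>
      connected {z \<in> up_map i j t ` cell_box i j. hess_patch k t z = 0} \<and>
      {z \<in> up_map i j t ` cell_box i j. hess_patch k t z = 0} \<noteq> {} \<and>
      (\<forall>z \<in> up_map i j t ` cell_box i j. hess_patch k t z = 0 \<longrightarrow>
         \<not> (hess_patch k t has_derivative (\<lambda>_. 0)) (at z))"
    proof (rule oval_transport[where g="?g t" and U="up_dom i j" and s="?s", OF _ _ _ _ open_up_dom cell_box_up_dom])
      fix w assume w: "w \<in> up_dom i j"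
      show "?g t w = hess_patch k t (up_map i j t w) * ?s w"
        using elim w by (intro hess_patch_up_map) auto
      show "?s w \<noteq> 0" using w elim by (auto simp: up_dom_def)
      show "up_map i j t differentiable (at w)"
        unfolding up_map_def differentiable_def by (rule exI) (rule derivative_intros | use elim in simp)+
      have "fst differentiable (at w)" "snd differentiable (at w)"
        by (auto intro: bounded_linear_imp_differentiable bounded_linear_fst bounded_linear_snd)
      then show "?s differentiable (at w)"
        using w by (auto simp: up_dom_def intro!: derivative_intros)
    qed (use elim in auto)
    then show ?case unfolding Let_def by blast
  qed
qed

text \<open>Discarding the dominated terms costs an error of order t relative to the square of the
  largest term. Dividing by the corner value then leaves \<open>cell_form\<close> above a small
  negative number, which for small \<open>t\<close> is within the margin of the box.\<close>

lemma up_localise: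
  assumes "i + j + 1 \<le> k"
  shows "\<forall>\<^sub>F t in at_right 0. \<forall>z. dominated k (True, i, j) t z \<and> hess_patch k t z \<ge> 0 \<longrightarrow>
           z \<in> up_map i j t ` cell_box i j"
proof -
  define \<theta> where "\<theta> = (real i + 1) * (real j + 1) / (2 * (real i + real j + 2))"
  have \<theta>: "\<theta> > 0" by (simp add: \<theta>_def)
  obtain C where C: "C > 0" "\<And>f g M \<epsilon>. \<lbrakk>\<And>q. q \<in> tri k \<Longrightarrow> \<bar>f q\<bar> \<le> M; \<And>q. q \<in> tri k \<Longrightarrow> \<bar>g q\<bar> \<le> M;
           \<And>q. q \<in> tri k \<Longrightarrow> \<bar>f q - g q\<bar> \<le> \<epsilon> * M; M \<ge> 0; \<epsilon> \<ge> 0\<rbrakk>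
           \<Longrightarrow> \<bar>hess_form (tri k) f - hess_form (tri k) g\<bar> \<le> C * \<epsilon> * M\<^sup>2"
    using hess_form_perturb[of k] by blast
  have "\<forall>\<^sub>F t in at_right 0. C * t \<le> 1 / 2" "\<forall>\<^sub>F t in at_right 0. 2 * C * t \<le> \<theta>"
    "\<forall>\<^sub>F t in at_right (0::real). 0 < t \<and> t < 1"
    by (rule eventually_small eventually_less_right; use \<theta> in simp)+
  then show ?thesis
  proof eventually_elim
    case (elim t)
    show ?case
    proof (intro allI impI)
      fix z assume z: "dominated k (True, i, j) t z \<and> hess_patch k t z \<ge> 0"
      define M f where "M = term_max k t z" and "f = term_at t z"
      define g where "g q = (if q \<in> verts (True, i, j) then f q else 0)" for q
      define u v w where "u = f (i, j)" and "v = f (i + 1, j)" and "w = f (i, j + 1)"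
      have M: "M > 0" "\<And>q. q \<in> tri k \<Longrightarrow> \<bar>f q\<bar> \<le> M"
        by (simp_all add: M_def f_def term_max_pos term_le_max)
      have off: "\<bar>f q\<bar> \<le> t * M" if "q \<in> tri k - verts (True, i, j)" for q
        using z that by (simp add: dominated_def M_def f_def)
      have "\<bar>hess_form (tri k) f - hess_form (tri k) g\<bar> \<le> C * t * M\<^sup>2"
        using M off elim by (intro C(2)) (auto simp: g_def)
      moreover have "hess_form (tri k) g = cell_form i j u v w"
        unfolding u_def v_def w_def
        by (subst hess_form_up[OF assms]) (auto simp: g_def verts_def)
      ultimately have cf: "cell_form i j u v w \<ge> - (C * t * M\<^sup>2)"
        using z unfolding hess_patch_def f_def[symmetric] by linarith
      have CtM: "C * t * M\<^sup>2 \<ge> 0" using C elim by simp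
      \<comment> \<open>The largest term is attained at a vertex, so these bounds make the corner
        value \<open>u\<close> comparable to it. This permits the division by \<open>u\<close>
        below.\<close>
      note b = cell_form_bounds[OF cf CtM]
      obtain q where q: "q \<in> tri k" "\<bar>f q\<bar> = M"
        unfolding f_def M_def by (rule term_max_attained)
      have "q \<in> verts (True, i, j)"
      proof (rule ccontr)
        assume "q \<notin> verts (True, i, j)"
        then have "M \<le> t * M" using off[of q] q by simp
        then show False using M(1) elim by (simp add: mult_le_cancel_right1)
      qed
      then have "f q \<in> {u, v, w}" by (auto simp: verts_def u_def v_def w_def)
      then have "(f q)\<^sup>2 \<le> u\<^sup>2 + C * t * M\<^sup>2" using b CtM by auto
      moreover have "(f q)\<^sup>2 = M\<^sup>2" using q(2) by (metis power2_abs)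
      moreover have "C * t * M\<^sup>2 \<le> 1 / 2 * M\<^sup>2" using elim by (intro mult_right_mono) auto
      ultimately have M2: "M\<^sup>2 \<le> 2 * u\<^sup>2" by linarith
      then have u0: "u \<noteq> 0" using M(1) by auto
      define x y where "x = t ^ (6 * i + 2 * j + 3) * fst z" and "y = t ^ (2 * i + 6 * j + 3) * snd z"
      have v: "v = u * (- x)" "w = u * (- y)"
        unfolding u_def v_def w_def f_def term_at_def x_def y_def
        by (simp_all add: ht_def power_add power2_eq_square algebra_simps flip: power_mult)
      have "- (2 * (C * t)) * u\<^sup>2 \<le> - (C * t * M\<^sup>2)"
        using mult_left_mono[OF M2, of "C * t"] C elim by simp
      also have "\<dots> \<le> u\<^sup>2 * cell_form i j 1 (- x) (- y)"
        using cf cell_form_scale[of i j u 1 "- x" "- y"] v by simp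
      finally have "- (2 * (C * t)) * u\<^sup>2 \<le> u\<^sup>2 * cell_form i j 1 (- x) (- y)" .
      moreover have "u\<^sup>2 > 0" using u0 by simp
      ultimately have "- (2 * (C * t)) \<le> cell_form i j 1 (- x) (- y)"
        by (metis mult.commute mult_le_cancel_left_pos)
      then have "(x, y) \<in> cell_box i j"
        using elim unfolding cell_box_def \<theta>_def[symmetric] by simp
      moreover have "z = up_map i j t (x, y)"
        using elim by (simp add: up_map_def x_def y_def)
      ultimately show "z \<in> up_map i j t ` cell_box i j" by blast
    qed
  qed
qed

text \<open>The size of the terms at a point determines the triangle. Two vertices may suffice for this, as an
  oval on a side of the big triangle touches a coordinate axis, where the third term vanishes.\<close>

definition profile :: "nat \<Rightarrow> bool \<times> nat \<times> nat \<Rightarrow> real \<Rightarrow> real \<Rightarrow> real \<Rightarrow> real \<times> real \<Rightarrow> bool" where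
  "profile k c \<delta> B t z \<longleftrightarrow> (\<forall>q\<in>tri k - verts c. \<bar>term_at t z q\<bar> \<le> B * t * term_max k t z) \<and>
     (\<exists>V\<subseteq>tri k. (\<forall>c'\<in>cells k. V \<subseteq> verts c' \<longrightarrow> c' = c) \<and> (\<forall>q\<in>V. \<bar>term_at t z q\<bar> \<ge> \<delta> * term_max k t z))"

lemma term_max_le: "(\<And>q. q \<in> tri k \<Longrightarrow> \<bar>term_at t z q\<bar> \<le> B) \<Longrightarrow> term_max k t z \<le> B"
  by (simp add: term_max_def)

text \<open>A side of the small triangle that lies on a leg of the big triangle belongs to no other
  cell, so there two vertices already identify the cell.\<close>

lemma up_cell_unique:
  assumes "(i, j) \<in> verts c" "(i + 1, j) \<in> verts c \<or> i = 0 \<and> (i, j + 1) \<in> verts c"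
    "(i, j + 1) \<in> verts c \<or> j = 0 \<and> (i + 1, j) \<in> verts c"
  shows "c = (True, i, j)"
proof -
  obtain up a b where c: "c = (up, a, b)" by (cases c)
  show ?thesis
    using assms unfolding c verts_def by (cases up) auto
qed

lemma down_cell_unique:
  assumes "(i + 1, j + 1) \<in> verts c" "(i, j + 1) \<in> verts c" "(i + 1, j) \<in> verts c"
  shows "c = (False, i, j)"
proof -
  obtain up a b where c: "c = (up, a, b)" by (cases c)
  show ?thesis
    using assms unfolding c verts_def by (cases up) auto
qed

lemma up_profile:
  assumes "i + j + 1 \<le> k"
  obtains \<delta> B where "\<delta> > 0"
    "\<forall>\<^sub>F t in at_right 0. \<forall>z \<in> up_map i j t ` cell_box i j. profile k (True, i, j) \<delta> B t z"
proof -
  define l where "l = 1 / (8 * (real i + real j + 2))"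
  have l: "l > 0" "l \<le> 1" by (auto simp: l_def)
  \<comment> \<open>Bounds the quotients of powers in \<open>up_terms\<close>, using that
    coordinates in the box are at most 2 in absolute value and at least \<open>l\<close> whenever
    they are divided by.\<close>
  define B where "B = (2 ^ k / l ^ i) * (2 ^ k / l ^ j)"
  have B: "B \<ge> 1"
  proof -
    have 1: "(1::real) \<le> 2 ^ k" by simp
    have 2: "0 < l ^ i" "l ^ i \<le> 1" "0 < l ^ j" "l ^ j \<le> 1" using l by (auto intro: power_le_one)
    have "l ^ i \<le> 2 ^ k" "l ^ j \<le> 2 ^ k" using 1 2 by linarith+
    then have "1 \<le> 2 ^ k / l ^ i" "1 \<le> 2 ^ k / l ^ j" using 2 by (simp_all add: pos_le_divide_eq)
    then show ?thesis unfolding B_def using mult_mono[of 1 "2 ^ k / l ^ i" 1 "2 ^ k / l ^ j"] by simp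
  qed
  have "\<forall>\<^sub>F t in at_right (0::real). 0 < t \<and> t < 1"
    by (rule eventually_less_right) simp
  then have "\<forall>\<^sub>F t in at_right 0. \<forall>z \<in> up_map i j t ` cell_box i j. profile k (True, i, j) (l / B) B t z"
  proof eventually_elim
    case (elim t)
    show ?case
    proof
      fix z assume "z \<in> up_map i j t ` cell_box i j"
      then obtain w where w: "w \<in> cell_box i j" and z: "z = up_map i j t w" by auto
      have wd: "w \<in> up_dom i j" using w cell_box_up_dom by auto
      note bb = cell_box_bounds[OF w, folded l_def]
      have le2: "\<bar>fst w\<bar> \<le> 2" "\<bar>snd w\<bar> \<le> 2"
        using bb(1,2) abs_le_square_iff[of "fst w" 2] abs_le_square_iff[of "snd w" 2] by simp_all
      define F where "F = up_terms i j t w"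
      define s where "s = (-1) ^ (i + j) * fst w ^ i * snd w ^ j / t ^ (3 * i\<^sup>2 + 2 * i * j + 3 * j\<^sup>2 + 3 * i + 3 * j)"
      have tm: "\<bar>term_at t z q\<bar> = \<bar>s\<bar> * \<bar>F q\<bar>" for q
        unfolding z s_def F_def by (subst term_at_up_map) (use elim wd in \<open>auto simp: abs_mult\<close>)
      have ratio: "\<bar>x ^ a / x ^ n\<bar> \<le> 2 ^ k / l ^ n" if "\<bar>x\<bar> \<le> 2" "n > 0 \<Longrightarrow> x \<ge> l" "a \<le> k" for x :: real and a n
      proof -
        have "\<bar>x\<bar> ^ a \<le> 2 ^ a" using that by (intro power_mono) auto
        also have "\<dots> \<le> 2 ^ k" using that by (intro power_increasing) auto
        finally have 1: "\<bar>x\<bar> ^ a \<le> 2 ^ k" .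
        have 2: "l ^ n \<le> \<bar>x\<bar> ^ n" using that l by (cases "n = 0") (auto intro!: power_mono)
        show ?thesis unfolding abs_divide power_abs
          by (rule frac_le) (use 1 2 l in auto)
      qed
      have F_le: "\<bar>F q\<bar> \<le> B * t ^ gam_up i j q" if "q \<in> tri k" for q
      proof -
        have q: "fst q \<le> k" "snd q \<le> k" using that by (auto simp: tri_def)
        have "\<bar>F q\<bar> = t ^ gam_up i j q * (\<bar>fst w ^ fst q / fst w ^ i\<bar> * \<bar>snd w ^ snd q / snd w ^ j\<bar>)"
          using elim by (simp add: F_def up_terms_def abs_mult power_abs)
        also have "\<dots> \<le> t ^ gam_up i j q * B"
          unfolding B_def using elim l bb le2 q
          by (intro mult_left_mono mult_mono ratio) auto
        finally show ?thesis by (simp add: mult.commute)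
      qed
      have sgn: "(-1 :: real) ^ (i + j + i + j) = 1" by (rule neg_one_even_power) presburger
      have p: "F (i, j) = 1" "F (i + 1, j) = - fst w" "F (i, j + 1) = - snd w"
        using wd sgn gam_up_vert[of "(i, j)" i j] gam_up_vert[of "(i + 1, j)" i j] gam_up_vert[of "(i, j + 1)" i j]
        by (simp_all add: F_def up_dom_def up_terms_def verts_def del: power_eq_0_iff)
      have ij: "(i, j) \<in> tri k" "(i + 1, j) \<in> tri k" "(i, j + 1) \<in> tri k"
        using assms by (auto simp: tri_def)
      have s_le: "\<bar>s\<bar> \<le> term_max k t z"
        using term_le_max[OF ij(1), of t z] p by (simp add: tm)
      have max_le: "term_max k t z \<le> B * \<bar>s\<bar>"
      proof (rule term_max_le)
        fix q assume "q \<in> tri k"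
        have "t ^ gam_up i j q \<le> 1" using elim by (intro power_le_one) auto
        then have "B * t ^ gam_up i j q \<le> B * 1" using B by (intro mult_left_mono) auto
        then have "\<bar>F q\<bar> \<le> B" using F_le[OF \<open>q \<in> tri k\<close>] by simp
        then show "\<bar>term_at t z q\<bar> \<le> B * \<bar>s\<bar>"
          unfolding tm by (subst mult.commute) (intro mult_right_mono, auto)
      qed
      have "\<bar>term_at t z q\<bar> \<le> B * t * term_max k t z" if q: "q \<in> tri k - verts (True, i, j)" for q
      proof -
        have "t ^ gam_up i j q \<le> t ^ 1"
          using gam_up_ge[of q i j] q elim by (intro power_decreasing) auto
        then have "B * t ^ gam_up i j q \<le> B * t" using B by (intro mult_left_mono) auto
        then have "\<bar>F q\<bar> \<le> B * t" using F_le[of q] q by simp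
        then have "\<bar>s\<bar> * \<bar>F q\<bar> \<le> term_max k t z * (B * t)"
          using s_le B elim by (intro mult_mono) auto
        then show ?thesis by (simp add: tm mult_ac)
      qed
      moreover have "\<exists>V\<subseteq>tri k. (\<forall>c'\<in>cells k. V \<subseteq> verts c' \<longrightarrow> c' = (True, i, j)) \<and>
          (\<forall>q\<in>V. \<bar>term_at t z q\<bar> \<ge> l / B * term_max k t z)"
      proof -
        \<comment> \<open>Only the vertices whose terms are not small. By
          \<open>cell_box_bounds\<close> one of them may drop out only next to a coordinate axis, in
          the cases covered by \<open>up_cell_unique\<close>.\<close>
        define V where "V = {q \<in> verts (True, i, j). \<bar>F q\<bar> \<ge> l}"
        have "(i, j) \<in> V" using l p by (simp add: V_def verts_def)
        moreover have "fst w \<ge> l \<Longrightarrow> (i + 1, j) \<in> V" "snd w \<ge> l \<Longrightarrow> (i, j + 1) \<in> V"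
          using l p by (auto simp: V_def verts_def)
        ultimately have "(i, j) \<in> V" "(i + 1, j) \<in> V \<or> i = 0 \<and> (i, j + 1) \<in> V"
          "(i, j + 1) \<in> V \<or> j = 0 \<and> (i + 1, j) \<in> V"
          using bb(3,4,5) by auto
        then have "c' = (True, i, j)" if "V \<subseteq> verts c'" for c'
          using that by (intro up_cell_unique) blast+
        moreover have "V \<subseteq> tri k" using ij by (auto simp: V_def verts_def)
        moreover have "\<bar>term_at t z q\<bar> \<ge> l / B * term_max k t z" if "q \<in> V" for q
        proof -
          have "l / B * term_max k t z \<le> l / B * (B * \<bar>s\<bar>)"
            using max_le l B by (intro mult_left_mono) auto
          also have "\<dots> = l * \<bar>s\<bar>" using B by simp
          also have "\<dots> \<le> \<bar>F q\<bar> * \<bar>s\<bar>" using that by (intro mult_right_mono) (auto simp: V_def)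
          finally show ?thesis by (simp add: tm mult.commute)
        qed
        ultimately show ?thesis by blast
      qed
      ultimately show "profile k (True, i, j) (l / B) B t z" by (simp add: profile_def)
    qed
  qed
  moreover have "l / B > 0" using l B by simp
  ultimately show thesis using that by blast
qed

section \<open>Downward triangles\<close>

text \<open>The coefficients of the relation between the weights in
  \<open>hess_form_down_reduce\<close>; they are also the coordinates of the point at which the
  second derivatives of the three terms cancel.\<close>

definition down_cx :: "nat \<Rightarrow> nat \<Rightarrow> real" where "down_cx i j = (real i + 2) / (real i + real j + 2)"
definition down_cy :: "nat \<Rightarrow> nat \<Rightarrow> real" where "down_cy i j = (real j + 2) / (real i + real j + 2)"

lemma down_c: "0 < down_cx i j" "down_cx i j \<le> 1" "0 < down_cy i j" "down_cy i j \<le> 1"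
  by (auto simp: down_cx_def down_cy_def)

text \<open>The blow-up of order \<open>t\<^sup>2\<close> at the point \<open>(down_cx i j, down_cy i j)\<close> where the three terms of a
  downward triangle cancel. The roles of the two coordinates are exchanged, since \<open>down_x\<close> multiplies the
  term \<open>(i, j + 1)\<close>.\<close>

definition down_x :: "nat \<Rightarrow> nat \<Rightarrow> real \<Rightarrow> real \<times> real \<Rightarrow> real" where
  "down_x i j t w = down_cx i j * (1 + t\<^sup>2 * down_cy i j * snd w)"

definition down_y :: "nat \<Rightarrow> nat \<Rightarrow> real \<Rightarrow> real \<times> real \<Rightarrow> real" where
  "down_y i j t w = down_cy i j * (1 + t\<^sup>2 * down_cx i j * fst w)"

definition down_map :: "nat \<Rightarrow> nat \<Rightarrow> real \<Rightarrow> real \<times> real \<Rightarrow> real \<times> real" where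
  "down_map i j t w = (1 / (t ^ (6 * i + 2 * j + 5) * down_x i j t w), 1 / (t ^ (2 * i + 6 * j + 5) * down_y i j t w))"

text \<open>The quotients of all terms by the term at \<open>(i + 1, j + 1)\<close>. Reciprocal
  rescaled coordinates correspond to the point reflection in \<open>gam_down\<close>, and the three
  vertices get the values 1, \<open>- x\<close> and \<open>- y\<close>.\<close>

definition rev_terms :: "nat \<Rightarrow> nat \<Rightarrow> real \<Rightarrow> real \<Rightarrow> real \<Rightarrow> nat \<times> nat \<Rightarrow> real" where
  "rev_terms i j t x y q = (-1) ^ (i + j + fst q + snd q) * t ^ gam_down i j q *
     (x ^ (i + 1) / x ^ fst q) * (y ^ (j + 1) / y ^ snd q)"

text \<open>What remains of \<open>rev_terms\<close> after eliminating \<open>(i + 1, j + 1)\<close>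
  and dividing by \<open>t\<^sup>2 * (down_cx i j * down_cy i j)\<close>, in a form that makes sense
  at t = 0. The last branch concerns points off the triangle, where \<open>gam_down\<close> is at
  least 2 and the subtraction is exact.\<close>

definition down_terms :: "nat \<Rightarrow> nat \<Rightarrow> real \<Rightarrow> real \<times> real \<Rightarrow> nat \<times> nat \<Rightarrow> real" where
  "down_terms i j t w q =
     (if q = (i + 1, j + 1) then 0 else if q = (i, j + 1) then - snd w else if q = (i + 1, j) then - fst w
      else (-1) ^ (i + j + fst q + snd q) * t ^ (gam_down i j q - 2) *
       (down_x i j t w ^ (i + 1) / down_x i j t w ^ fst q) * (down_y i j t w ^ (j + 1) / down_y i j t w ^ snd q)
       / (down_cx i j * down_cy i j))"

lemma term_at_rev:
  assumes "t > 0" "x \<noteq> 0" "y \<noteq> 0"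
  shows "term_at t (1 / (t ^ (6 * i + 2 * j + 5) * x), 1 / (t ^ (2 * i + 6 * j + 5) * y)) q =
    ((-1) ^ (i + j) / (t ^ (3 * i\<^sup>2 + 2 * i * j + 3 * j\<^sup>2 + 5 * i + 5 * j + 2) * x ^ (i + 1) * y ^ (j + 1))) *
    rev_terms i j t x y q"
proof -
  define C1 where "C1 = 3 * i\<^sup>2 + 2 * i * j + 3 * j\<^sup>2 + 5 * i + 5 * j + 2"
  define e where "e = (6 * i + 2 * j + 5) * fst q + (2 * i + 6 * j + 5) * snd q"
  have "t ^ ht q * t ^ C1 = t ^ gam_down i j q * t ^ e"
    unfolding power_add[symmetric] C1_def e_def using ht_gam_down[of q i j] by (simp only: add.assoc)
  then have e: "t ^ ht q / t ^ e = t ^ gam_down i j q / t ^ C1"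
    using assms by (simp add: field_simps)
  have "term_at t (1 / (t ^ (6 * i + 2 * j + 5) * x), 1 / (t ^ (2 * i + 6 * j + 5) * y)) q =
      (-1) ^ (fst q + snd q) * (t ^ ht q / t ^ e) / x ^ fst q / y ^ snd q"
    by (simp add: term_at_def e_def power_divide power_mult power_add power_mult_distrib)
  also have "\<dots> = (-1) ^ (fst q + snd q) * (t ^ gam_down i j q / t ^ C1) / x ^ fst q / y ^ snd q"
    unfolding e ..
  also have "\<dots> = ((-1) ^ (i + j) / (t ^ C1 * x ^ (i + 1) * y ^ (j + 1))) * rev_terms i j t x y q"
  proof -
    have "e' * (g / d) / u / v = (e / (d * a * b)) * ((e * e') * g * (a / u) * (b / v))"
      if "e * e = 1" "a \<noteq> 0" "b \<noteq> 0" for e e' g d u v a b :: real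
    proof -
      have ee: "e * (e * r) = r" for r using that(1) by (simp flip: mult.assoc)
      show ?thesis using that by (simp add: ee)
    qed
    moreover have "(-1) ^ (i + j) * (-1) ^ (i + j) = (1::real)" by (simp flip: power_mult_distrib)
    moreover have "(-1) ^ (i + j + fst q + snd q) = (-1) ^ (i + j) * ((-1) ^ (fst q + snd q) :: real)"
      by (simp add: power_add)
    moreover have "x ^ (i + 1) \<noteq> 0" "y ^ (j + 1) \<noteq> 0" using assms by auto
    ultimately show ?thesis unfolding rev_terms_def by metis
  qed
  finally show ?thesis unfolding C1_def .
qed

lemma rev_terms_vert:
  assumes "x \<noteq> 0" "y \<noteq> 0"
  shows "rev_terms i j t x y (i + 1, j + 1) = 1" "rev_terms i j t x y (i, j + 1) = - x"
    "rev_terms i j t x y (i + 1, j) = - y"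
proof -
  have sgn: "(-1 :: real) ^ (i + j + i + j) = 1" by (rule neg_one_even_power) presburger
  show "rev_terms i j t x y (i + 1, j + 1) = 1" "rev_terms i j t x y (i, j + 1) = - x"
    "rev_terms i j t x y (i + 1, j) = - y"
    using sgn assms gam_down_vert[of "(i + 1, j + 1)" i j] gam_down_vert[of "(i, j + 1)" i j]
      gam_down_vert[of "(i + 1, j)" i j]
    by (simp_all add: rev_terms_def verts_def)
qed

lemma rev_terms_down_terms:
  assumes "q \<notin> verts (False, i, j)"
  shows "rev_terms i j t (down_x i j t w) (down_y i j t w) q =
    t\<^sup>2 * (down_cx i j * down_cy i j) * down_terms i j t w q"
proof -
  have q: "q \<noteq> (i + 1, j + 1)" "q \<noteq> (i, j + 1)" "q \<noteq> (i + 1, j)" using assms by (auto simp: verts_def)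
  have "gam_down i j q \<ge> 2"
    using gam_down_ge[OF assms] gam_down_corner[of i j] by (cases "q = (i, j)") auto
  then have "t ^ gam_down i j q = t\<^sup>2 * t ^ (gam_down i j q - 2)"
    by (metis le_add_diff_inverse power_add)
  then show ?thesis
    using q down_c[of i j] by (simp add: down_terms_def rev_terms_def)
qed

text \<open>Elimination changes the vertex values \<open>- x\<close> and \<open>- y\<close> into
  their deviations from the cancellation point, which the blow-up makes multiples of t^2. Off the
  triangle the same factor comes from \<open>gam_down \<ge> 2\<close>, so it can be extracted from
  all values at once.\<close>

lemma hess_form_rev_terms:
  assumes "i + j + 2 \<le> k" "down_x i j t w \<noteq> 0" "down_y i j t w \<noteq> 0"
  shows "hess_form (tri k) (rev_terms i j t (down_x i j t w) (down_y i j t w)) =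
    (t\<^sup>2 * (down_cx i j * down_cy i j))\<^sup>2 * hess_form (tri k) (down_terms i j t w)"
proof -
  let ?f = "rev_terms i j t (down_x i j t w) (down_y i j t w)"
  have c: "down_cx i j \<noteq> 0" "down_cy i j \<noteq> 0" using down_c[of i j] by auto
  note v = rev_terms_vert[OF assms(2,3), of i j t]
  show ?thesis
    unfolding hess_form_scale[symmetric] hess_form_down_reduce[OF assms(1), of ?f, folded down_cx_def down_cy_def]
  proof (rule hess_form_cong)
    fix q assume "q \<in> tri k"
    show "(?f((i + 1, j + 1) := 0, (i, j + 1) := ?f (i, j + 1) + down_cx i j * ?f (i + 1, j + 1),
       (i + 1, j) := ?f (i + 1, j) + down_cy i j * ?f (i + 1, j + 1))) q =
       t\<^sup>2 * (down_cx i j * down_cy i j) * down_terms i j t w q"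
    proof (cases "q \<in> verts (False, i, j)")
      case True
      then consider "q = (i + 1, j + 1)" | "q = (i, j + 1)" | "q = (i + 1, j)" by (auto simp: verts_def)
      then show ?thesis
        by cases (use v in \<open>simp_all add: down_terms_def down_x_def down_y_def algebra_simps\<close>)
    next
      case False
      then have q: "q \<noteq> (i + 1, j + 1)" "q \<noteq> (i, j + 1)" "q \<noteq> (i + 1, j)" by (auto simp: verts_def)
      then show ?thesis
        using rev_terms_down_terms[OF False, of t w] by simp
    qed
  qed
qed

lemma hess_patch_down_map:
  assumes "i + j + 2 \<le> k" "t > 0" "down_x i j t w \<noteq> 0" "down_y i j t w \<noteq> 0"
  shows "hess_form (tri k) (down_terms i j t w) = hess_patch k t (down_map i j t w) *
    (t ^ (3 * i\<^sup>2 + 2 * i * j + 3 * j\<^sup>2 + 5 * i + 5 * j + 2) * down_x i j t w ^ (i + 1) * down_y i j t w ^ (j + 1)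
      / (t\<^sup>2 * (down_cx i j * down_cy i j)))\<^sup>2"
proof -
  define C1 where "C1 = 3 * i\<^sup>2 + 2 * i * j + 3 * j\<^sup>2 + 5 * i + 5 * j + 2"
  have "hess_patch k t (down_map i j t w) =
    ((-1) ^ (i + j) / (t ^ C1 * down_x i j t w ^ (i + 1) * down_y i j t w ^ (j + 1)))\<^sup>2 *
     hess_form (tri k) (rev_terms i j t (down_x i j t w) (down_y i j t w))"
    unfolding hess_patch_def hess_form_scale[symmetric] down_map_def C1_def
    by (rule hess_form_cong) (rule term_at_rev[OF assms(2-4)])
  also have "\<dots> = ((-1) ^ (i + j) / (t ^ C1 * down_x i j t w ^ (i + 1) * down_y i j t w ^ (j + 1)))\<^sup>2 *
     ((t\<^sup>2 * (down_cx i j * down_cy i j))\<^sup>2 * hess_form (tri k) (down_terms i j t w))"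
    by (simp only: hess_form_rev_terms[OF assms(1,3,4)])
  finally have 1: "hess_patch k t (down_map i j t w) = \<dots>" .
  have "h = (e / a)\<^sup>2 * (b\<^sup>2 * h) * (a / b)\<^sup>2" if "e\<^sup>2 = 1" "a \<noteq> 0" "b \<noteq> 0" for e a b h :: real
    using that by (simp add: power_divide)
  moreover have "((-1) ^ (i + j))\<^sup>2 = (1::real)" by (simp flip: power_mult power_mult_distrib)
  moreover have "t ^ C1 * down_x i j t w ^ (i + 1) * down_y i j t w ^ (j + 1) \<noteq> 0" using assms by simp
  moreover have "t\<^sup>2 * (down_cx i j * down_cy i j) \<noteq> 0" using assms down_c[of i j] by simp
  ultimately show ?thesis unfolding 1 C1_def[symmetric] by blast
qed

text \<open>At t = 0 the corner \<open>(i, j)\<close>, whose excess is exactly 2, survives with the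
  value 1. This is the positive square that the downward triangle lacks.\<close>

lemma down_terms_0:
  assumes "i + j + 2 \<le> k"
  shows "hess_form (tri k) (down_terms i j 0 w) = cell_form i j 1 (- fst w) (- snd w)"
proof -
  have c: "down_cx i j \<noteq> 0" "down_cy i j \<noteq> 0" using down_c[of i j] by auto
  have sgn: "(-1 :: real) ^ (i + j + i + j) = 1" by (rule neg_one_even_power) presburger
  have "down_terms i j 0 w q = 0" if "q \<in> tri k - {(i, j), (i + 1, j), (i, j + 1)}" for q
  proof (cases "q = (i + 1, j + 1)")
    case False
    then have "gam_down i j q \<ge> 4" using that by (intro gam_down_ge) (auto simp: verts_def)
    then show ?thesis using that by (simp add: down_terms_def)
  qed (simp add: down_terms_def)
  then have "hess_form (tri k) (down_terms i j 0 w) = cell_form i j (down_terms i j 0 w (i, j))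
      (down_terms i j 0 w (i + 1, j)) (down_terms i j 0 w (i, j + 1))"
    using assms(1) by (intro hess_form_up) auto
  also have "\<dots> = cell_form i j 1 (- fst w) (- snd w)"
    using c sgn by (simp add: down_terms_def gam_down_corner down_x_def down_y_def)
  finally show ?thesis .
qed

lemma cell_box_abs_le:
  assumes "w \<in> cell_box i j"
  shows "\<bar>fst w\<bar> \<le> 2" "\<bar>snd w\<bar> \<le> 2"
  using cell_box_bounds(1,2)[OF assms] abs_le_square_iff[of "fst w" 2] abs_le_square_iff[of "snd w" 2] by simp_all

lemma one_plus_bounds:
  fixes t c s :: real
  assumes "0 \<le> t" "t \<le> 1 / 2" "0 < c" "c \<le> 1" "\<bar>s\<bar> \<le> 2"
  shows "1 / 2 \<le> 1 + t\<^sup>2 * c * s" "1 + t\<^sup>2 * c * s \<le> 3 / 2"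
proof -
  have "t\<^sup>2 \<le> (1 / 2)\<^sup>2" using assms by (intro power_mono) auto
  then have "t\<^sup>2 \<le> 1 / 4" by (simp add: power2_eq_square)
  then have "\<bar>t\<^sup>2 * c * s\<bar> \<le> 1 / 4 * 1 * 2"
    unfolding abs_mult using assms by (intro mult_mono) auto
  then show "1 / 2 \<le> 1 + t\<^sup>2 * c * s" "1 + t\<^sup>2 * c * s \<le> 3 / 2" by linarith+
qed

lemma down_xy_bounds:
  assumes "0 \<le> t" "t \<le> 1 / 2" "w \<in> cell_box i j"
  shows "down_cx i j / 2 \<le> down_x i j t w" "down_x i j t w \<le> 2"
    "down_cy i j / 2 \<le> down_y i j t w" "down_y i j t w \<le> 2"
proof -
  note c = down_c[of i j] and w = cell_box_abs_le[OF assms(3)]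
  note x = one_plus_bounds[OF assms(1,2) c(3,4) w(2)] and y = one_plus_bounds[OF assms(1,2) c(1,2) w(1)]
  show "down_cx i j / 2 \<le> down_x i j t w" "down_cy i j / 2 \<le> down_y i j t w"
    using mult_left_mono[OF x(1), of "down_cx i j"] mult_left_mono[OF y(1), of "down_cy i j"] c
    by (simp_all add: down_x_def down_y_def)
  have "down_x i j t w \<le> 1 * (3 / 2)" "down_y i j t w \<le> 1 * (3 / 2)"
    unfolding down_x_def down_y_def using c x y by (intro mult_mono; simp)+
  then show "down_x i j t w \<le> 2" "down_y i j t w \<le> 2" by simp_all
qed

lemma down_oval:
  assumes "i + j + 2 \<le> k"
  shows "\<forall>\<^sub>F t in at_right 0.
    (let R = down_map i j t ` cell_box i j; Z = {z \<in> R. hess_patch k t z = 0} in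
       compact Z \<and> connected Z \<and> Z \<noteq> {} \<and> (\<forall>z\<in>Z. \<not> (hess_patch k t has_derivative (\<lambda>_. 0)) (at z)))"
proof -
  let ?g = "\<lambda>t w. hess_form (tri k) (down_terms i j t w)"
  note c = down_c[of i j]
  \<comment> \<open>The parameter stops at 1/2 because in the box the coordinates of
    \<open>w\<close> are at most 2 in absolute value, which keeps the factors
    \<open>1 + t\<^sup>2 * c * s\<close> at least 1/2.\<close>
  have nz: "down_x i j t w \<noteq> 0" "down_y i j t w \<noteq> 0" if "t \<in> {0..1/2}" "w \<in> cell_box i j" for t w
    using down_xy_bounds[of t w i j] that c by auto
  have fam: "C1_family (1/2) (cell_box i j) (down_x i j)" "C1_family (1/2) (cell_box i j) (down_y i j)"
    unfolding down_x_def down_y_def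
    by (intro C1_family_mult C1_family_add C1_family_power C1_family_const C1_family_param
         C1_family_fst C1_family_snd)+
  have "C1_family (1/2) (cell_box i j) (\<lambda>t w. down_terms i j t w q)" for q
  proof (cases "q \<in> verts (False, i, j)")
    case True
    then consider "q = (i + 1, j + 1)" | "q = (i, j + 1)" | "q = (i + 1, j)" by (auto simp: verts_def)
    then show ?thesis
      by cases (simp_all add: down_terms_def C1_family_minus)
  next
    case False
    then have q: "q \<noteq> (i + 1, j + 1)" "q \<noteq> (i, j + 1)" "q \<noteq> (i + 1, j)" by (auto simp: verts_def)
    have "C1_family (1/2) (cell_box i j) (\<lambda>t w. (-1) ^ (i + j + fst q + snd q) * t ^ (gam_down i j q - 2) *
       (down_x i j t w ^ (i + 1) / down_x i j t w ^ fst q) * (down_y i j t w ^ (j + 1) / down_y i j t w ^ snd q)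
       / (down_cx i j * down_cy i j))"
      using nz c by (intro C1_family_mult C1_family_divide C1_family_power C1_family_const C1_family_param fam) auto
    then show ?thesis unfolding down_terms_def using q by simp
  qed
  then have "C1_family (1/2) (cell_box i j) ?g"
    by (intro C1_family_hess_form)
  then have "\<forall>\<^sub>F t in at_right 0. compact {w \<in> cell_box i j. ?g t w = 0} \<and> connected {w \<in> cell_box i j. ?g t w = 0} \<and>
           {w \<in> cell_box i j. ?g t w = 0} \<noteq> {} \<and>
           (\<forall>w \<in> cell_box i j. ?g t w = 0 \<longrightarrow> \<not> (?g t has_derivative (\<lambda>_. 0)) (at w))"
    by (intro oval_cell[of "1/2" i j ?g UNIV] down_terms_0 assms) auto
  moreover have "\<forall>\<^sub>F t in at_right (0::real). 0 < t \<and> t < 1 / 2"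
    by (rule eventually_less_right) simp
  ultimately show ?thesis
  proof eventually_elim
    case (elim t)
    let ?s = "\<lambda>w. (t ^ (3 * i\<^sup>2 + 2 * i * j + 3 * j\<^sup>2 + 5 * i + 5 * j + 2) * down_x i j t w ^ (i + 1) * down_y i j t w ^ (j + 1)
      / (t\<^sup>2 * (down_cx i j * down_cy i j)))\<^sup>2"
    let ?U = "{w. down_x i j t w \<noteq> 0 \<and> down_y i j t w \<noteq> 0}"
    have "compact {z \<in> down_map i j t ` cell_box i j. hess_patch k t z = 0} \<and>
      connected {z \<in> down_map i j t ` cell_box i j. hess_patch k t z = 0} \<and>
      {z \<in> down_map i j t ` cell_box i j. hess_patch k t z = 0} \<noteq> {} \<and>
      (\<forall>z \<in> down_map i j t ` cell_box i j. hess_patch k t z = 0 \<longrightarrow>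
         \<not> (hess_patch k t has_derivative (\<lambda>_. 0)) (at z))"
    proof (rule oval_transport[where g="?g t" and U="?U" and s="?s"])
      show "open ?U"
        unfolding down_x_def down_y_def by (intro open_Collect_conj open_Collect_neq continuous_intros)
      show "cell_box i j \<subseteq> ?U" using nz[of t] elim by auto
      fix w assume w: "w \<in> ?U"
      show "?g t w = hess_patch k t (down_map i j t w) * ?s w"
        using elim w by (intro hess_patch_down_map assms) auto
      show "?s w \<noteq> 0" using w elim c by auto
      have d: "fst differentiable (at w)" "snd differentiable (at w)"
        by (auto intro: bounded_linear_imp_differentiable bounded_linear_fst bounded_linear_snd)
      have dxy: "down_x i j t differentiable (at w)" "down_y i j t differentiable (at w)"
        unfolding down_x_def[abs_def] down_y_def[abs_def] by (intro derivative_intros d)+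
      show "?s differentiable (at w)"
        using elim c by (intro derivative_intros dxy) auto
      have "(\<lambda>w. 1 / (t ^ (6 * i + 2 * j + 5) * down_x i j t w)) differentiable (at w)"
        "(\<lambda>w. 1 / (t ^ (2 * i + 6 * j + 5) * down_y i j t w)) differentiable (at w)"
        using elim w by (auto intro!: derivative_intros dxy)
      then show "down_map i j t differentiable (at w)"
        unfolding down_map_def[abs_def] differentiable_def using has_derivative_Pair by blast
    qed (use elim in auto)
    then show ?case unfolding Let_def by blast
  qed
qed

section \<open>Sizes of the terms on the region of a downward triangle\<close>

lemma ratio_bound:
  fixes x l :: real
  assumes "0 < l" "l \<le> x" "x \<le> 2" "l \<le> 1" "a \<le> k"
  shows "\<bar>x ^ n / x ^ a\<bar> \<le> 2 ^ n / l ^ k"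
proof -
  have "l ^ k \<le> l ^ a" using assms by (intro power_decreasing) auto
  also have "\<dots> \<le> x ^ a" using assms by (intro power_mono) auto
  finally have 1: "l ^ k \<le> x ^ a" .
  have 2: "x ^ n \<le> 2 ^ n" using assms by (intro power_mono) auto
  have "\<bar>x ^ n / x ^ a\<bar> = x ^ n / x ^ a" using assms by simp
  also have "\<dots> \<le> 2 ^ n / l ^ k" by (rule frac_le) (use 1 2 assms in auto)
  finally show ?thesis .
qed

lemma rev_terms_bound:
  assumes "0 \<le> t" "t \<le> 1" "q \<in> tri k"
    and "down_cx i j / 2 \<le> x" "x \<le> 2" "down_cy i j / 2 \<le> y" "y \<le> 2"
  shows "\<bar>rev_terms i j t x y q\<bar> \<le>
    t ^ gam_down i j q * ((2 ^ (i + 1) / (down_cx i j / 2) ^ k) * (2 ^ (j + 1) / (down_cy i j / 2) ^ k))"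
proof -
  note c = down_c[of i j]
  have q: "fst q \<le> k" "snd q \<le> k" using assms(3) by (auto simp: tri_def)
  have "\<bar>rev_terms i j t x y q\<bar> = t ^ gam_down i j q * (\<bar>x ^ (i + 1) / x ^ fst q\<bar> * \<bar>y ^ (j + 1) / y ^ snd q\<bar>)"
    using assms(1) by (simp add: rev_terms_def abs_mult power_abs)
  also have "\<dots> \<le> t ^ gam_down i j q * ((2 ^ (i + 1) / (down_cx i j / 2) ^ k) * (2 ^ (j + 1) / (down_cy i j / 2) ^ k))"
    using assms c q by (intro mult_left_mono mult_mono ratio_bound) auto
  finally show ?thesis .
qed

lemma down_profile:
  assumes "i + j + 2 \<le> k"
  obtains \<delta> B where "\<delta> > 0"
    "\<forall>\<^sub>F t in at_right 0. \<forall>z \<in> down_map i j t ` cell_box i j. profile k (False, i, j) \<delta> B t z"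
proof -
  note c = down_c[of i j]
  define B where "B = (2 ^ (i + 1) / (down_cx i j / 2) ^ k) * (2 ^ (j + 1) / (down_cy i j / 2) ^ k) + 1"
  define l where "l = min (down_cx i j / 2) (down_cy i j / 2)"
  have l: "l > 0" "l \<le> 1" "l \<le> down_cx i j / 2" "l \<le> down_cy i j / 2" using c by (auto simp: l_def min_def)
  have B: "B \<ge> 1" using c by (auto simp: B_def)
  have "\<forall>\<^sub>F t in at_right (0::real). 0 < t \<and> t < 1 / 2"
    by (rule eventually_less_right) simp
  then have "\<forall>\<^sub>F t in at_right 0. \<forall>z \<in> down_map i j t ` cell_box i j. profile k (False, i, j) (l / B) B t z"
  proof eventually_elim
    case (elim t)
    show ?case
    proof
      fix z assume "z \<in> down_map i j t ` cell_box i j"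
      then obtain w where w: "w \<in> cell_box i j" and z: "z = down_map i j t w" by auto
      define x y where "x = down_x i j t w" and "y = down_y i j t w"
      have xy: "down_cx i j / 2 \<le> x" "x \<le> 2" "down_cy i j / 2 \<le> y" "y \<le> 2"
        unfolding x_def y_def using down_xy_bounds[of t w i j] elim w by auto
      have nz: "x \<noteq> 0" "y \<noteq> 0" using xy c by auto
      define F where "F = rev_terms i j t x y"
      define s where "s = (-1) ^ (i + j) / (t ^ (3 * i\<^sup>2 + 2 * i * j + 3 * j\<^sup>2 + 5 * i + 5 * j + 2) * x ^ (i + 1) * y ^ (j + 1))"
      have tm: "\<bar>term_at t z q\<bar> = \<bar>s\<bar> * \<bar>F q\<bar>" for q
        unfolding z down_map_def x_def[symmetric] y_def[symmetric] s_def F_def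
        by (subst term_at_rev) (use elim nz in \<open>auto simp: abs_mult\<close>)
      have F_le: "\<bar>F q\<bar> \<le> B * t ^ gam_down i j q" if "q \<in> tri k" for q
      proof -
        have "\<bar>F q\<bar> \<le> t ^ gam_down i j q * (B - 1)"
          unfolding F_def B_def using rev_terms_bound[of t q k i j x y] elim that xy by simp
        also have "\<dots> \<le> t ^ gam_down i j q * B" using elim by (intro mult_left_mono) auto
        finally show ?thesis by (simp add: mult.commute)
      qed
      note p = rev_terms_vert[OF nz, of i j t, folded F_def]
      have ij: "(i + 1, j + 1) \<in> tri k" "(i + 1, j) \<in> tri k" "(i, j + 1) \<in> tri k"
        using assms by (auto simp: tri_def)
      have s_le: "\<bar>s\<bar> \<le> term_max k t z"
        using term_le_max[OF ij(1), of t z] unfolding tm p by simp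
      have max_le: "term_max k t z \<le> B * \<bar>s\<bar>"
      proof (rule term_max_le)
        fix q assume "q \<in> tri k"
        have "t ^ gam_down i j q \<le> 1" using elim by (intro power_le_one) auto
        then have "B * t ^ gam_down i j q \<le> B * 1" using B by (intro mult_left_mono) auto
        then have "\<bar>F q\<bar> \<le> B" using F_le[OF \<open>q \<in> tri k\<close>] by simp
        then show "\<bar>term_at t z q\<bar> \<le> B * \<bar>s\<bar>"
          unfolding tm by (subst mult.commute) (intro mult_right_mono, auto)
      qed
      have "\<bar>term_at t z q\<bar> \<le> B * t * term_max k t z" if q: "q \<in> tri k - verts (False, i, j)" for q
      proof -
        have "gam_down i j q \<ge> 2"
          using gam_down_ge[of q i j] gam_down_corner[of i j] q by (cases "q = (i, j)") auto
        then have "t ^ gam_down i j q \<le> t ^ 1"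
          using elim by (intro power_decreasing) auto
        then have "B * t ^ gam_down i j q \<le> B * t" using B by (intro mult_left_mono) auto
        then have "\<bar>F q\<bar> \<le> B * t" using F_le[of q] q by simp
        then have "\<bar>s\<bar> * \<bar>F q\<bar> \<le> term_max k t z * (B * t)"
          using s_le B elim by (intro mult_mono) auto
        then show ?thesis by (simp add: tm mult_ac)
      qed
      moreover have "\<exists>V\<subseteq>tri k. (\<forall>c'\<in>cells k. V \<subseteq> verts c' \<longrightarrow> c' = (False, i, j)) \<and>
          (\<forall>q\<in>V. \<bar>term_at t z q\<bar> \<ge> l / B * term_max k t z)"
      proof -
        \<comment> \<open>All three vertices can be taken: near the cancellation point
          \<open>x\<close> and \<open>y\<close> are bounded away from 0, so none of the three terms
          is small.\<close>
        define V where "V = verts (False, i, j)"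
        have "c' = (False, i, j)" if "V \<subseteq> verts c'" for c'
          using that by (intro down_cell_unique) (auto simp: V_def verts_def[of "(False, i, j)"])
        moreover have "V \<subseteq> tri k" using ij by (auto simp: V_def verts_def)
        moreover have "\<bar>term_at t z q\<bar> \<ge> l / B * term_max k t z" if "q \<in> V" for q
        proof -
          consider "q = (i + 1, j + 1)" | "q = (i, j + 1)" | "q = (i + 1, j)"
            using \<open>q \<in> V\<close> by (auto simp: V_def verts_def)
          then have Fl: "\<bar>F q\<bar> \<ge> l" by cases (use p l xy in auto)
          have "l / B * term_max k t z \<le> l / B * (B * \<bar>s\<bar>)"
            using max_le l B by (intro mult_left_mono) auto
          also have "\<dots> = l * \<bar>s\<bar>" using B by simp
          also have "\<dots> \<le> \<bar>F q\<bar> * \<bar>s\<bar>" using Fl by (intro mult_right_mono) auto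
          finally show ?thesis by (simp add: tm mult.commute)
        qed
        ultimately show ?thesis by blast
      qed
      ultimately show "profile k (False, i, j) (l / B) B t z" by (simp add: profile_def)
    qed
  qed
  moreover have "l / B > 0" using l B by simp
  ultimately show thesis using that by blast
qed

text \<open>The coarse half of the localisation. Without the dominated terms the form is
  \<open>cell_form\<close> with corner value 0, and almost nonnegativity forces the two reduced
  values to be small compared with the largest term. This pins \<open>x\<close> and \<open>y\<close>
  only up to a constant, not yet at the scale t^2.\<close>

lemma down_localise_chart:
  assumes "i + j + 2 \<le> k" "\<eta> > 0" "\<eta> \<le> 1 / 4"
  shows "\<forall>\<^sub>F t in at_right 0. \<forall>z. dominated k (False, i, j) t z \<and> hess_patch k t z \<ge> 0 \<longrightarrow>
    (\<exists>x y. x \<noteq> 0 \<and> y \<noteq> 0 \<and> \<bar>x - down_cx i j\<bar> \<le> \<eta> \<and> \<bar>y - down_cy i j\<bar> \<le> \<eta> \<and>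
       z = (1 / (t ^ (6 * i + 2 * j + 5) * x), 1 / (t ^ (2 * i + 6 * j + 5) * y)))"
proof -
  define \<mu> where "\<mu> = \<eta> / 2"
  have \<mu>: "\<mu> > 0" "\<mu> \<le> 1 / 2" using assms by (auto simp: \<mu>_def)
  define X0 Y0 where "X0 = down_cx i j" and "Y0 = down_cy i j"
  have c: "0 < X0" "X0 \<le> 1" "0 < Y0" "Y0 \<le> 1" using down_c[of i j] by (auto simp: X0_def Y0_def)
  obtain C where C: "C > 0" "\<And>f g M \<epsilon>. \<lbrakk>\<And>q. q \<in> tri k \<Longrightarrow> \<bar>f q\<bar> \<le> M; \<And>q. q \<in> tri k \<Longrightarrow> \<bar>g q\<bar> \<le> M;
           \<And>q. q \<in> tri k \<Longrightarrow> \<bar>f q - g q\<bar> \<le> \<epsilon> * M; M \<ge> 0; \<epsilon> \<ge> 0\<rbrakk>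
           \<Longrightarrow> \<bar>hess_form (tri k) f - hess_form (tri k) g\<bar> \<le> C * \<epsilon> * M\<^sup>2"
    using hess_form_perturb[of k] by blast
  have "\<forall>\<^sub>F t in at_right 0. C * t \<le> \<mu>\<^sup>2" "\<forall>\<^sub>F t in at_right (0::real). 0 < t \<and> t < 1"
    by (rule eventually_small eventually_less_right; use \<mu> in simp)+
  then show ?thesis
  proof eventually_elim
    case (elim t)
    show ?case
    proof (intro allI impI)
      fix z assume z: "dominated k (False, i, j) t z \<and> hess_patch k t z \<ge> 0"
      define M f where "M = term_max k t z" and "f = term_at t z"
      define g where "g q = (if q \<in> verts (False, i, j) then f q else 0)" for q
      define g' where "g' = g((i + 1, j + 1) := 0, (i, j + 1) := g (i, j + 1) + X0 * g (i + 1, j + 1),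
       (i + 1, j) := g (i + 1, j) + Y0 * g (i + 1, j + 1))"
      define S r s where "S = f (i + 1, j + 1)" and "r = f (i + 1, j) + Y0 * S" and "s = f (i, j + 1) + X0 * S"
      have M: "M > 0" "\<And>q. q \<in> tri k \<Longrightarrow> \<bar>f q\<bar> \<le> M"
        by (simp_all add: M_def f_def term_max_pos term_le_max)
      have off: "\<bar>f q\<bar> \<le> t * M" if "q \<in> tri k - verts (False, i, j)" for q
        using z that by (simp add: dominated_def M_def f_def)
      have "\<bar>hess_form (tri k) f - hess_form (tri k) g\<bar> \<le> C * t * M\<^sup>2"
        using M off elim by (intro C(2)) (auto simp: g_def)
      moreover have "hess_form (tri k) g = cell_form i j 0 r s"
      proof -
        have "hess_form (tri k) g = hess_form (tri k) g'"
          unfolding g'_def X0_def Y0_def down_cx_def down_cy_def by (rule hess_form_down_reduce[OF assms(1)])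
        also have "\<dots> = cell_form i j (g' (i, j)) (g' (i + 1, j)) (g' (i, j + 1))"
          using assms(1) by (intro hess_form_up) (auto simp: g'_def g_def verts_def)
        finally show ?thesis by (simp add: g'_def g_def verts_def r_def s_def S_def)
      qed
      ultimately have cf: "cell_form i j 0 r s \<ge> - (C * t * M\<^sup>2)"
        using z unfolding hess_patch_def f_def[symmetric] by linarith
      have CtM: "C * t * M\<^sup>2 \<ge> 0" using C elim by simp
      have "C * t * M\<^sup>2 \<le> \<mu>\<^sup>2 * M\<^sup>2" using elim by (intro mult_right_mono) auto
      then have "r\<^sup>2 \<le> (\<mu> * M)\<^sup>2" "s\<^sup>2 \<le> (\<mu> * M)\<^sup>2"
        using cell_form_bounds[OF cf CtM] by (simp_all add: power_mult_distrib)
      then have rs: "\<bar>r\<bar> \<le> \<mu> * M" "\<bar>s\<bar> \<le> \<mu> * M"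
        using \<mu> M(1) abs_le_square_iff[of r "\<mu> * M"] abs_le_square_iff[of s "\<mu> * M"] by simp_all
      obtain q where q: "q \<in> tri k" "\<bar>f q\<bar> = M"
        unfolding f_def M_def by (rule term_max_attained)
      have "q \<in> verts (False, i, j)"
      proof (rule ccontr)
        assume "q \<notin> verts (False, i, j)"
        then have "M \<le> t * M" using off[of q] q by simp
        then show False using M(1) elim by (simp add: mult_le_cancel_right1)
      qed
      \<comment> \<open>Since \<open>r\<close> and \<open>s\<close> are at most half of the largest
        term, \<open>S\<close> is at least half of it, and dividing by \<open>S\<close> turns their
        smallness into closeness of \<open>x\<close>, \<open>y\<close> to \<open>X0\<close>,
        \<open>Y0\<close>.\<close>
      then have "f q \<in> {S, s - X0 * S, r - Y0 * S}" by (auto simp: verts_def r_def s_def S_def)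
      moreover have "\<bar>X0 * S\<bar> \<le> \<bar>S\<bar>" "\<bar>Y0 * S\<bar> \<le> \<bar>S\<bar>"
        using c by (auto simp: abs_mult mult_left_le_one_le)
      moreover have "\<mu> * M \<ge> 0" using \<mu> M by simp
      ultimately have "\<bar>f q\<bar> \<le> \<bar>S\<bar> + \<mu> * M"
        using rs by (auto simp del: mult_nonneg_nonneg)
      moreover have "\<mu> * M \<le> 1 / 2 * M" using \<mu> M by (intro mult_right_mono) auto
      ultimately have MS: "M \<le> 2 * \<bar>S\<bar>" using q by linarith
      then have S0: "S \<noteq> 0" using M(1) by auto
      then have z0: "fst z \<noteq> 0" "snd z \<noteq> 0" by (auto simp: S_def f_def term_at_def)
      define x y where "x = 1 / (t ^ (6 * i + 2 * j + 5) * fst z)" and "y = 1 / (t ^ (2 * i + 6 * j + 5) * snd z)"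
      have xy: "x \<noteq> 0" "y \<noteq> 0" using z0 elim by (auto simp: x_def y_def)
      have zeq: "z = (1 / (t ^ (6 * i + 2 * j + 5) * x), 1 / (t ^ (2 * i + 6 * j + 5) * y))"
        using z0 elim by (simp add: x_def y_def prod_eq_iff)
      define e where "e = (-1) ^ (i + j) / (t ^ (3 * i\<^sup>2 + 2 * i * j + 3 * j\<^sup>2 + 5 * i + 5 * j + 2) * x ^ (i + 1) * y ^ (j + 1))"
      have f: "f q = e * rev_terms i j t x y q" for q
        unfolding f_def e_def by (subst zeq) (rule term_at_rev; use elim xy in simp)
      have "S = e" "f (i, j + 1) = e * (- x)" "f (i + 1, j) = e * (- y)"
        unfolding S_def f rev_terms_vert[OF xy] by simp_all
      then have "s = S * (X0 - x)" "r = S * (Y0 - y)"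
        by (simp_all add: s_def r_def algebra_simps)
      then have "\<bar>S\<bar> * \<bar>x - X0\<bar> = \<bar>s\<bar>" "\<bar>S\<bar> * \<bar>y - Y0\<bar> = \<bar>r\<bar>"
        by (simp_all add: abs_mult abs_minus_commute)
      moreover have "\<mu> * M \<le> \<bar>S\<bar> * \<eta>"
        using mult_left_mono[OF MS, of \<mu>] \<mu> by (simp add: \<mu>_def mult.commute)
      ultimately have "\<bar>S\<bar> * \<bar>x - X0\<bar> \<le> \<bar>S\<bar> * \<eta>" "\<bar>S\<bar> * \<bar>y - Y0\<bar> \<le> \<bar>S\<bar> * \<eta>"
        using rs by linarith+
      then have "\<bar>x - X0\<bar> \<le> \<eta>" "\<bar>y - Y0\<bar> \<le> \<eta>"
        using S0 by (simp_all add: mult_le_cancel_left_pos)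
      then show "\<exists>x y. x \<noteq> 0 \<and> y \<noteq> 0 \<and> \<bar>x - down_cx i j\<bar> \<le> \<eta> \<and> \<bar>y - down_cy i j\<bar> \<le> \<eta> \<and>
         z = (1 / (t ^ (6 * i + 2 * j + 5) * x), 1 / (t ^ (2 * i + 6 * j + 5) * y))"
        using xy zeq unfolding X0_def Y0_def by blast
    qed
  qed
qed

text \<open>A bootstrap. The coarse localisation controls all values except the blown-up coordinates
  of \<open>w\<close>; nonnegativity of the form bounds these by 4. With \<open>w\<close> bounded,
  the corner value differs from 1 by O(t^2), and the comparison with \<open>cell_form\<close> at
  corner value 1 becomes sharp enough for the box.\<close>

lemma down_localise:
  assumes "i + j + 2 \<le> k"
  shows "\<forall>\<^sub>F t in at_right 0. \<forall>z. dominated k (False, i, j) t z \<and> hess_patch k t z \<ge> 0 \<longrightarrow>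
           z \<in> down_map i j t ` cell_box i j"
proof -
  define \<theta> where "\<theta> = (real i + 1) * (real j + 1) / (2 * (real i + real j + 2))"
  have \<theta>: "\<theta> > 0" by (simp add: \<theta>_def)
  define X0 Y0 where "X0 = down_cx i j" and "Y0 = down_cy i j"
  have c: "0 < X0" "X0 \<le> 1" "0 < Y0" "Y0 \<le> 1" using down_c[of i j] by (auto simp: X0_def Y0_def)
  define \<eta> where "\<eta> = min (X0 / 4) (Y0 / 4)"
  have \<eta>: "\<eta> > 0" "\<eta> \<le> 1 / 4" "\<eta> \<le> X0 / 4" "\<eta> \<le> Y0 / 4" using c by (auto simp: \<eta>_def min_def)
  define B where "B = (2 ^ (i + 1) / (X0 / 2) ^ k) * (2 ^ (j + 1) / (Y0 / 2) ^ k) / (X0 * Y0)"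
  have B: "B \<ge> 0" using c by (simp add: B_def)
  obtain C where C: "C > 0" "\<And>f g M \<epsilon>. \<lbrakk>\<And>q. q \<in> tri k \<Longrightarrow> \<bar>f q\<bar> \<le> M; \<And>q. q \<in> tri k \<Longrightarrow> \<bar>g q\<bar> \<le> M;
           \<And>q. q \<in> tri k \<Longrightarrow> \<bar>f q - g q\<bar> \<le> \<epsilon> * M; M \<ge> 0; \<epsilon> \<ge> 0\<rbrakk>
           \<Longrightarrow> \<bar>hess_form (tri k) f - hess_form (tri k) g\<bar> \<le> C * \<epsilon> * M\<^sup>2"
    using hess_form_perturb[of k] by blast
  have "\<forall>\<^sub>F t in at_right 0. (4 * C * B) * t \<le> 1 / 2" "\<forall>\<^sub>F t in at_right 0. B * t \<le> 1 / 4"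
    "\<forall>\<^sub>F t in at_right 0. (16 * C * (24 + B)) * t \<le> \<theta>" "\<forall>\<^sub>F t in at_right (0::real). 0 < t \<and> t < 1"
    by (rule eventually_small eventually_less_right; use \<theta> in simp)+
  then show ?thesis using down_localise_chart[OF assms \<eta>(1,2)]
  proof eventually_elim
    case (elim t)
    have t: "0 < t" "t < 1" "t\<^sup>2 \<le> t" "t\<^sup>2 > 0" using elim by (auto simp: power2_eq_square)
    show ?case
    proof (intro allI impI)
      fix z assume z: "dominated k (False, i, j) t z \<and> hess_patch k t z \<ge> 0"
      then obtain x y where xy0: "x \<noteq> 0" "y \<noteq> 0" and xy: "\<bar>x - X0\<bar> \<le> \<eta>" "\<bar>y - Y0\<bar> \<le> \<eta>"
        and zeq: "z = (1 / (t ^ (6 * i + 2 * j + 5) * x), 1 / (t ^ (2 * i + 6 * j + 5) * y))"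
        using elim unfolding X0_def Y0_def by blast
      \<comment> \<open>Inverts the blow-up, with the two coordinates exchanged as in
        \<open>down_x\<close> and \<open>down_y\<close>.\<close>
      define w where "w = ((y / Y0 - 1) / (t\<^sup>2 * X0), (x / X0 - 1) / (t\<^sup>2 * Y0))"
      have dx: "down_x i j t w = x" and dy: "down_y i j t w = y"
        using c t unfolding down_x_def down_y_def X0_def[symmetric] Y0_def[symmetric] w_def by simp_all
      have zw: "z = down_map i j t w" unfolding down_map_def dx dy by (rule zeq)
      have x: "X0 / 2 \<le> x" "x \<le> 2" "Y0 / 2 \<le> y" "y \<le> 2" "x \<le> 5 / 4 * X0" "y \<le> 5 / 4 * Y0"
        "3 / 4 * X0 \<le> x" "3 / 4 * Y0 \<le> y"
        using xy \<eta> c by linarith+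
      define D where "D = down_terms i j t w"
      have D: "hess_form (tri k) D \<ge> 0"
        unfolding D_def using hess_patch_down_map[OF assms t(1), of w] dx dy xy0 z zw by simp
      define u v v' where "u = D (i, j)" and "v = D (i + 1, j)" and "v' = D (i, j + 1)"
      have v: "v = - fst w" "v' = - snd w" by (auto simp: v_def v'_def D_def down_terms_def)
      define p r where "p = x / X0" and "r = y / Y0"
      have pr: "3 / 4 \<le> p" "p \<le> 5 / 4" "3 / 4 \<le> r" "r \<le> 5 / 4"
        using x c by (auto simp: p_def r_def field_simps)
      have sgn: "(-1 :: real) ^ (i + j + i + j) = 1" by (rule neg_one_even_power) presburger
      have u: "u = p * r"
        using sgn xy0 unfolding u_def D_def down_terms_def dx dy X0_def[symmetric] Y0_def[symmetric]
        by (simp add: gam_down_corner p_def r_def)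
      have u_bounds: "9 / 16 \<le> u" "u \<le> 25 / 16"
        using mult_mono[of "3/4" p "3/4" r] mult_mono[of p "5/4" r "5/4"] pr by (simp_all add: u)
      \<comment> \<open>Apart from the eliminated vertex, these points have excess at least 4, and
        two powers of \<open>t\<close> are left after the division by t^2.\<close>
      have off: "\<bar>D q\<bar> \<le> B * t\<^sup>2" if q: "q \<in> tri k" "q \<notin> verts (True, i, j)" for q
      proof (cases "q = (i + 1, j + 1)")
        case True
        then show ?thesis using B by (simp add: D_def down_terms_def)
      next
        case False
        then have qv: "q \<notin> verts (False, i, j)" "q \<noteq> (i, j)" using q by (auto simp: verts_def)
        have "t\<^sup>2 * (X0 * Y0) * \<bar>D q\<bar> = \<bar>rev_terms i j t x y q\<bar>"
          using rev_terms_down_terms[OF qv(1), of t w] c unfolding dx dy D_def X0_def[symmetric] Y0_def[symmetric]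
          by (simp add: abs_mult)
        also have "\<dots> \<le> t ^ gam_down i j q * (B * (X0 * Y0))"
          using rev_terms_bound[of t q k i j x y] t q x c unfolding B_def X0_def[symmetric] Y0_def[symmetric]
          by simp
        also have "\<dots> \<le> t ^ 4 * (B * (X0 * Y0))"
        proof (rule mult_right_mono)
          show "t ^ gam_down i j q \<le> t ^ 4"
            using gam_down_ge[OF qv] t(1,2) by (intro power_decreasing) auto
        qed (use B c in auto)
        also have "\<dots> = t\<^sup>2 * (X0 * Y0) * (B * t\<^sup>2)"
          by (simp add: power2_eq_square power4_eq_xxxx)
        finally show ?thesis using t c by (simp add: mult_le_cancel_left_pos)
      qed
      have Bt: "B * t\<^sup>2 \<le> 1 / 4" using mult_left_mono[OF t(3) B] elim by linarith
      define g where "g q = (if q \<in> verts (True, i, j) then D q else 0)" for q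
      \<comment> \<open>A priori \<open>M\<close> may be arbitrarily large, as \<open>w\<close> is
        not yet bounded. Errors are therefore kept relative to \<open>M\<close> until
        \<open>M \<le> 4\<close> is known.\<close>
      define M where "M = Max {u, \<bar>v\<bar>, \<bar>v'\<bar>}"
      have M: "u \<le> M" "\<bar>v\<bar> \<le> M" "\<bar>v'\<bar> \<le> M" "M \<in> {u, \<bar>v\<bar>, \<bar>v'\<bar>}"
        unfolding M_def by (auto simp: max_def)
      have Dv: "\<bar>D q\<bar> \<le> M" if "q \<in> verts (True, i, j)" for q
        using that M u_bounds by (auto simp: verts_def u_def v_def v'_def)
      have DM: "\<bar>D q\<bar> \<le> M" if "q \<in> tri k" for q
        using Dv[of q] off[OF that] Bt M u_bounds by (cases "q \<in> verts (True, i, j)") auto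
      have "\<bar>hess_form (tri k) D - hess_form (tri k) g\<bar> \<le> C * (4 * B * t\<^sup>2) * M\<^sup>2"
      proof (rule C(2))
        fix q assume q: "q \<in> tri k"
        have "B * t\<^sup>2 * 1 \<le> B * t\<^sup>2 * (4 * M)" using B t M u_bounds by (intro mult_left_mono) auto
        then show "\<bar>D q - g q\<bar> \<le> 4 * B * t\<^sup>2 * M"
          using off[OF q] B M u_bounds by (auto simp: g_def mult_ac)
        show "\<bar>D q\<bar> \<le> M" "\<bar>g q\<bar> \<le> M"
          using DM[OF q] M u_bounds by (auto simp: g_def)
      qed (use B M u_bounds in auto)
      moreover have "hess_form (tri k) g = cell_form i j u v v'"
      proof -
        have "hess_form (tri k) g = cell_form i j (g (i, j)) (g (i + 1, j)) (g (i, j + 1))"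
        proof (rule hess_form_up)
          show "i + j + 1 \<le> k" using assms by linarith
          show "g q = 0" if "q \<in> tri k - {(i, j), (i + 1, j), (i, j + 1)}" for q
            using that by (simp add: g_def verts_def)
        qed
        then show ?thesis by (simp add: g_def verts_def u_def v_def v'_def)
      qed
      ultimately have cf: "cell_form i j u v v' \<ge> - (C * (4 * B * t\<^sup>2) * M\<^sup>2)"
        using D by linarith
      have nn: "C * (4 * B * t\<^sup>2) * M\<^sup>2 \<ge> 0" using C B by simp
      have "C * (4 * B * t\<^sup>2) \<le> 4 * C * B * t"
        using mult_left_mono[OF t(3), of "4 * C * B"] C B by (simp add: mult_ac)
      then have "C * (4 * B * t\<^sup>2) \<le> 1 / 2" using elim(1) by linarith
      then have "C * (4 * B * t\<^sup>2) * M\<^sup>2 \<le> 1 / 2 * M\<^sup>2" by (intro mult_right_mono) auto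
      moreover have "M\<^sup>2 = u\<^sup>2 \<or> M\<^sup>2 = v\<^sup>2 \<or> M\<^sup>2 = v'\<^sup>2" using M(4) by auto
      then have "M\<^sup>2 \<le> u\<^sup>2 + C * (4 * B * t\<^sup>2) * M\<^sup>2"
        using cell_form_bounds[OF cf nn] nn by (elim disjE) linarith+
      ultimately have "M\<^sup>2 \<le> 2 * u\<^sup>2" by linarith
      also have "u\<^sup>2 \<le> (25 / 16)\<^sup>2" using u_bounds by (intro power_mono) auto
      finally have "M\<^sup>2 \<le> 4\<^sup>2" by (simp add: power2_eq_square)
      then have M4: "M \<le> 4" by (rule power2_le_imp_le) simp
      have w4: "\<bar>fst w\<bar> \<le> 4" "\<bar>snd w\<bar> \<le> 4" using M M4 v by auto
      have p1: "p - 1 = t\<^sup>2 * Y0 * snd w" and r1: "r - 1 = t\<^sup>2 * X0 * fst w"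
        using c t by (simp_all add: p_def r_def w_def)
      have "\<bar>p - 1\<bar> \<le> t\<^sup>2 * 1 * 4" "\<bar>r - 1\<bar> \<le> t\<^sup>2 * 1 * 4"
        unfolding p1 r1 abs_mult using c w4 by (intro mult_mono; simp)+
      moreover have "u - 1 = (p - 1) * r + (r - 1)" by (simp add: u algebra_simps)
      moreover have "\<bar>(p - 1) * r\<bar> \<le> (t\<^sup>2 * 1 * 4) * 2"
        unfolding abs_mult using calculation(1) pr by (intro mult_mono) auto
      ultimately have u1: "\<bar>u - 1\<bar> \<le> 24 * t\<^sup>2" by linarith
      \<comment> \<open>Replacing the corner value \<open>u\<close> by exactly 1 costs only O(t^2),
        now that \<open>u - 1\<close> is of this order.\<close>
      define h where "h q = (if q = (i, j) then 1 else g q)" for q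
      have "\<bar>hess_form (tri k) D - hess_form (tri k) h\<bar> \<le> C * ((24 + B) * t\<^sup>2) * 4\<^sup>2"
      proof (rule C(2))
        fix q assume q: "q \<in> tri k"
        have "B * t\<^sup>2 \<ge> 0" "24 * t\<^sup>2 \<ge> 0" using B by auto
        moreover have "(24 + B) * t\<^sup>2 * 4 = 4 * (24 * t\<^sup>2) + 4 * (B * t\<^sup>2)" by (simp add: algebra_simps)
        moreover have "\<bar>D q - h q\<bar> \<le> max (24 * t\<^sup>2) (B * t\<^sup>2)"
          using off[OF q] u1 calculation by (auto simp: h_def g_def u_def)
        ultimately show "\<bar>D q - h q\<bar> \<le> (24 + B) * t\<^sup>2 * 4" by linarith
        show "\<bar>D q\<bar> \<le> 4" "\<bar>h q\<bar> \<le> 4"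
          using DM[OF q] M4 by (auto simp: h_def g_def)
      qed (use B in auto)
      moreover have "hess_form (tri k) h = cell_form i j 1 v v'"
      proof -
        have "hess_form (tri k) h = cell_form i j (h (i, j)) (h (i + 1, j)) (h (i, j + 1))"
        proof (rule hess_form_up)
          show "i + j + 1 \<le> k" using assms by linarith
          show "h q = 0" if "q \<in> tri k - {(i, j), (i + 1, j), (i, j + 1)}" for q
            using that by (simp add: h_def g_def verts_def)
        qed
        then show ?thesis by (simp add: h_def g_def verts_def v_def v'_def)
      qed
      moreover have "C * ((24 + B) * t\<^sup>2) * 4\<^sup>2 \<le> 16 * C * (24 + B) * t"
        using mult_left_mono[OF t(3), of "16 * C * (24 + B)"] C B by (simp add: mult_ac)
      ultimately have "cell_form i j 1 (- fst w) (- snd w) \<ge> - \<theta>"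
        using D elim unfolding v by linarith
      then have "w \<in> cell_box i j" by (simp add: cell_box_def \<theta>_def)
      then show "z \<in> down_map i j t ` cell_box i j" using zw by blast
    qed
  qed
qed

section \<open>Assembling the ovals\<close>

text \<open>Each piece and the finite union of the others are disjoint closed sets, so a connected
  subset of the whole union that contains one piece cannot meet another.\<close>

lemma components_disjoint_compact_Union:
  fixes Z :: "'i \<Rightarrow> 'a::t2_space set"
  assumes "finite I" and Z: "\<And>i. i \<in> I \<Longrightarrow> compact (Z i)" "\<And>i. i \<in> I \<Longrightarrow> connected (Z i)" "\<And>i. i \<in> I \<Longrightarrow> Z i \<noteq> {}"
    and disj: "\<And>i j. \<lbrakk>i \<in> I; j \<in> I; i \<noteq> j\<rbrakk> \<Longrightarrow> Z i \<inter> Z j = {}"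
  shows "components (\<Union>i\<in>I. Z i) = Z ` I" "inj_on Z I"
proof -
  have comp: "Z i \<in> components (\<Union>i\<in>I. Z i)" if i: "i \<in> I" for i
    unfolding in_components_maximal
  proof (intro conjI allI impI)
    fix D assume D: "D \<noteq> {} \<and> Z i \<subseteq> D \<and> D \<subseteq> (\<Union>i\<in>I. Z i) \<and> connected D"
    let ?R = "\<Union>j\<in>I - {i}. Z j"
    have "closed (Z i)" "closed ?R"
      using assms i by (auto intro!: closed_UN compact_imp_closed)
    moreover have "Z i \<inter> ?R = {}" using disj i by blast
    moreover have "D \<subseteq> Z i \<union> ?R" using D by blast
    ultimately have "Z i \<inter> D = {} \<or> ?R \<inter> D = {}"
      using connected_closedD[of D "Z i" ?R] D by blast
    then show "D = Z i" using D Z(3)[OF i] \<open>D \<subseteq> Z i \<union> ?R\<close> by blast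
  qed (use Z i in auto)
  show "components (\<Union>i\<in>I. Z i) = Z ` I"
  proof (intro subset_antisym subsetI)
    fix C assume C: "C \<in> components (\<Union>i\<in>I. Z i)"
    then obtain x where "x \<in> C" using in_components_nonempty by fastforce
    then obtain i where i: "i \<in> I" "x \<in> Z i" using C in_components_subset by blast
    then have "C = Z i" using components_nonoverlap[OF C comp[OF i(1)]] \<open>x \<in> C\<close> by blast
    then show "C \<in> Z ` I" using i by blast
  qed (use comp in auto)
  show "inj_on Z I"
    using disj Z(3) by (intro inj_onI) (metis Int_absorb)
qed

text \<open>The upward and downward cells form staircases with k (k + 1) / 2 and k (k - 1) / 2
  elements.\<close>

lemma card_cells: "finite (cells k)" "card (cells k) = k\<^sup>2"
proof -
  define T where "T n = {(i, j). i + j < n}" for n :: nat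
  have fin: "finite (T n)" for n
    by (rule finite_subset[of _ "{..n} \<times> {..n}"]) (auto simp: T_def)
  have T: "2 * card (T n) = n * (n + 1)" for n
  proof (induction n)
    case (Suc n)
    have "T (Suc n) = T n \<union> (\<lambda>i. (i, n - i)) ` {..n}"
      by (auto simp: T_def image_iff less_Suc_eq)
    moreover have "card (T n \<union> (\<lambda>i. (i, n - i)) ` {..n}) = card (T n) + card ((\<lambda>i. (i, n - i)) ` {..n})"
      using fin by (intro card_Un_disjoint) (auto simp: T_def)
    moreover have "card ((\<lambda>i. (i, n - i)) ` {..n}) = n + 1"
      by (subst card_image) (auto simp: inj_on_def)
    ultimately show ?case using Suc by simp
  qed (simp add: T_def)
  have eq: "cells k = Pair True ` T k \<union> Pair False ` T (k - 1)"
    by (auto simp: cells_def T_def split: if_splits)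
  show "finite (cells k)" unfolding eq using fin by auto
  have "card (cells k) = card (T k) + card (T (k - 1))"
    unfolding eq using fin by (subst card_Un_disjoint) (auto simp: card_image inj_on_def)
  moreover have "2 * (card (T k) + card (T (k - 1))) = 2 * k\<^sup>2"
    unfolding distrib_left T by (cases k) (auto simp: power2_eq_square algebra_simps)
  ultimately show "card (cells k) = k\<^sup>2" by simp
qed

definition region :: "bool \<times> nat \<times> nat \<Rightarrow> real \<Rightarrow> (real \<times> real) set" where
  "region c t = (case c of (up, i, j) \<Rightarrow> (if up then up_map i j t else down_map i j t) ` cell_box i j)"

lemma region_oval:
  assumes "c \<in> cells k"
  shows "\<forall>\<^sub>F t in at_right 0.
    (let Z = {z \<in> region c t. hess_patch k t z = 0} in
       compact Z \<and> connected Z \<and> Z \<noteq> {} \<and> (\<forall>z\<in>Z. \<not> (hess_patch k t has_derivative (\<lambda>_. 0)) (at z)))"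
proof -
  obtain up i j where c: "c = (up, i, j)" by (cases c)
  show ?thesis
    using assms up_oval[of i j k] down_oval[of i j k] unfolding c region_def Let_def
    by (cases up) (auto simp: cells_def)
qed

lemma region_localise:
  assumes "c \<in> cells k"
  shows "\<forall>\<^sub>F t in at_right 0. \<forall>z. dominated k c t z \<and> hess_patch k t z \<ge> 0 \<longrightarrow> z \<in> region c t"
proof -
  obtain up i j where c: "c = (up, i, j)" by (cases c)
  show ?thesis
    using assms up_localise[of i j k] down_localise[of i j k] unfolding c region_def
    by (cases up) (auto simp: cells_def)
qed

lemma region_profile:
  assumes "c \<in> cells k"
  shows "\<exists>\<delta> B. \<delta> > 0 \<and> (\<forall>\<^sub>F t in at_right 0. \<forall>z\<in>region c t. profile k c \<delta> B t z)"
proof -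
  obtain up i j where c: "c = (up, i, j)" by (cases c)
  show ?thesis
  proof (cases up)
    case True
    then have "i + j + 1 \<le> k" using assms by (simp add: c cells_def)
    from up_profile[OF this] obtain \<delta> B where "\<delta> > 0"
      "\<forall>\<^sub>F t in at_right 0. \<forall>z\<in>up_map i j t ` cell_box i j. profile k (True, i, j) \<delta> B t z" by blast
    then show ?thesis using True unfolding c region_def by auto
  next
    case False
    then have "i + j + 2 \<le> k" using assms by (simp add: c cells_def)
    from down_profile[OF this] obtain \<delta> B where "\<delta> > 0"
      "\<forall>\<^sub>F t in at_right 0. \<forall>z\<in>down_map i j t ` cell_box i j. profile k (False, i, j) \<delta> B t z" by blast
    then show ?thesis using False unfolding c region_def by auto
  qed
qed

text \<open>If the cells differed, some term that is large according to \<open>c'\<close> would lie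
  off the triangle \<open>c\<close> and be small there. This is how regions of different cells are
  seen to be disjoint although they live in different charts.\<close>

lemma profile_unique:
  assumes "profile k c \<delta> B t z" "profile k c' \<delta>' B' t z" "B * t < \<delta>'" "c \<in> cells k"
  shows "c = c'"
proof (rule ccontr)
  assume "c \<noteq> c'"
  obtain V where V: "V \<subseteq> tri k" "\<And>a. a \<in> cells k \<Longrightarrow> V \<subseteq> verts a \<Longrightarrow> a = c'"
    "\<And>q. q \<in> V \<Longrightarrow> \<bar>term_at t z q\<bar> \<ge> \<delta>' * term_max k t z"
    using assms(2) unfolding profile_def by blast
  then obtain q where q: "q \<in> V" "q \<notin> verts c" using \<open>c \<noteq> c'\<close> assms(4) by blast
  then have "\<bar>term_at t z q\<bar> \<le> B * t * term_max k t z"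
    using V(1) assms(1) unfolding profile_def by blast
  then have "\<delta>' * term_max k t z \<le> B * t * term_max k t z"
    using V(3)[OF q(1)] by linarith
  then show False using assms(3) term_max_pos[of k t z] by simp
qed

theorem theorem1p1:
  fixes d :: nat
  assumes "d \<ge> 4"
  shows "\<exists>Q :: real poly poly.
           total_deg Q = d \<and>
           smooth_real_curve (Hess Q) \<and>
           card {C \<in> components (real_curve (Hess Q)). compact C} = (d - 2)\<^sup>2"
proof -
  define k where "k = d - 2"
  have k: "k \<ge> 1" "d = k + 2" using assms by (auto simp: k_def)
  have "\<forall>c\<in>cells k. \<exists>\<delta> B. \<delta> > 0 \<and> (\<forall>\<^sub>F t in at_right 0. \<forall>z\<in>region c t. profile k c \<delta> B t z)"
    using region_profile by blast
  from bchoice[OF this] obtain \<delta> where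
    "\<forall>c\<in>cells k. \<exists>B. \<delta> c > 0 \<and> (\<forall>\<^sub>F t in at_right 0. \<forall>z\<in>region c t. profile k c (\<delta> c) B t z)"
    by blast
  from bchoice[OF this] obtain B where \<delta>B: "\<And>c. c \<in> cells k \<Longrightarrow> \<delta> c > 0"
    "\<And>c. c \<in> cells k \<Longrightarrow> \<forall>\<^sub>F t in at_right 0. \<forall>z\<in>region c t. profile k c (\<delta> c) (B c) t z"
    by blast
  \<comment> \<open>As there are finitely many cells, one \<open>t\<close> serves all of them. The
    half in \<open>\<delta> c' / 2\<close> later gives the strict inequality that
    \<open>profile_unique\<close> asks for.\<close>
  have "\<forall>\<^sub>F t in at_right 0. \<forall>c\<in>cells k.
    (let Z = {z \<in> region c t. hess_patch k t z = 0} in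
       compact Z \<and> connected Z \<and> Z \<noteq> {} \<and> (\<forall>z\<in>Z. \<not> (hess_patch k t has_derivative (\<lambda>_. 0)) (at z)))"
    "\<forall>\<^sub>F t in at_right 0. \<forall>c\<in>cells k. \<forall>z. dominated k c t z \<and> hess_patch k t z \<ge> 0 \<longrightarrow> z \<in> region c t"
    "\<forall>\<^sub>F t in at_right 0. \<forall>c\<in>cells k. \<forall>z\<in>region c t. profile k c (\<delta> c) (B c) t z"
    "\<forall>\<^sub>F t in at_right 0. \<forall>c\<in>cells k. \<forall>c'\<in>cells k. B c * t \<le> \<delta> c' / 2"
    "\<forall>\<^sub>F t in at_right (0::real). 0 < t \<and> t < 1"
    by (intro eventually_ball_finite card_cells ballI region_oval region_localise \<delta>B(2) eventually_small
        eventually_less_right; use \<delta>B(1) in simp)+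
  then have "\<forall>\<^sub>F t in at_right 0. (\<forall>c\<in>cells k.
    (let Z = {z \<in> region c t. hess_patch k t z = 0} in
       compact Z \<and> connected Z \<and> Z \<noteq> {} \<and> (\<forall>z\<in>Z. \<not> (hess_patch k t has_derivative (\<lambda>_. 0)) (at z)))) \<and>
    (\<forall>c\<in>cells k. \<forall>z. dominated k c t z \<and> hess_patch k t z \<ge> 0 \<longrightarrow> z \<in> region c t) \<and>
    (\<forall>c\<in>cells k. \<forall>z\<in>region c t. profile k c (\<delta> c) (B c) t z) \<and>
    (\<forall>c\<in>cells k. \<forall>c'\<in>cells k. B c * t \<le> \<delta> c' / 2) \<and> 0 < t \<and> t < 1"
    by eventually_elim blast
  from eventually_happens'[OF trivial_limit_at_right_real this]
  obtain t where oval: "\<forall>c\<in>cells k.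
    (let Z = {z \<in> region c t. hess_patch k t z = 0} in
       compact Z \<and> connected Z \<and> Z \<noteq> {} \<and> (\<forall>z\<in>Z. \<not> (hess_patch k t has_derivative (\<lambda>_. 0)) (at z)))"
    and loc: "\<forall>c\<in>cells k. \<forall>z. dominated k c t z \<and> hess_patch k t z \<ge> 0 \<longrightarrow> z \<in> region c t"
    and prof: "\<forall>c\<in>cells k. \<forall>z\<in>region c t. profile k c (\<delta> c) (B c) t z"
    and small: "\<forall>c\<in>cells k. \<forall>c'\<in>cells k. B c * t \<le> \<delta> c' / 2"
    and t: "0 < t" "t < 1"
    by (elim exE conjE) (rule that)
  define Z where "Z c = {z \<in> region c t. hess_patch k t z = 0}" for c
  define Q where "Q = patch_poly k t"
  have ev: "eval2 (Hess Q) (fst z) (snd z) = hess_patch k t z" for z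
    unfolding Q_def eval2_Hess_patch_poly hess_patch_def by simp
  have curve: "real_curve (Hess Q) = (\<Union>c\<in>cells k. Z c)"
  proof (intro subset_antisym subsetI)
    fix z assume "z \<in> real_curve (Hess Q)"
    then have z: "hess_patch k t z = 0" using ev[of z] by (auto simp: real_curve_def)
    \<comment> \<open>Every point of the plane is dominated by some cell, so localisation leaves no
      zero of the Hessian outside the regions.\<close>
    obtain c where c: "c \<in> cells k" "dominated k c t z" using ex_dominated[OF k(1) t] by blast
    moreover have "z \<in> region c t" using spec[OF bspec[OF loc c(1)], of z] c(2) z by simp
    ultimately show "z \<in> (\<Union>c\<in>cells k. Z c)" using z unfolding Z_def by blast
  next
    fix z assume "z \<in> (\<Union>c\<in>cells k. Z c)"
    then show "z \<in> real_curve (Hess Q)" using ev[of z] by (auto simp: real_curve_def Z_def case_prod_beta)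
  qed
  have Zc: "compact (Z c)" "connected (Z c)" "Z c \<noteq> {}"
    "\<And>z. z \<in> Z c \<Longrightarrow> \<not> (hess_patch k t has_derivative (\<lambda>_. 0)) (at z)" if "c \<in> cells k" for c
    using bspec[OF oval that] unfolding Let_def Z_def[symmetric] by blast+
  have disj: "Z c \<inter> Z c' = {}" if "c \<in> cells k" "c' \<in> cells k" "c \<noteq> c'" for c c'
  proof (rule ccontr)
    assume "Z c \<inter> Z c' \<noteq> {}"
    then obtain z where "z \<in> region c t" "z \<in> region c' t" by (auto simp: Z_def)
    then have "profile k c (\<delta> c) (B c) t z" "profile k c' (\<delta> c') (B c') t z" using prof that by auto
    moreover have "B c * t < \<delta> c'" using bspec[OF bspec[OF small that(1)] that(2)] \<delta>B(1)[OF that(2)] by linarith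
    ultimately show False using profile_unique that by blast
  qed
  have comps: "components (real_curve (Hess Q)) = Z ` cells k" "inj_on Z (cells k)"
    unfolding curve using components_disjoint_compact_Union[of "cells k" Z] card_cells Zc disj by auto
  have "{C \<in> components (real_curve (Hess Q)). compact C} = Z ` cells k"
    unfolding comps using Zc by auto
  then have "card {C \<in> components (real_curve (Hess Q)). compact C} = k\<^sup>2"
    using comps(2) card_cells by (simp add: card_image)
  moreover have "eval2 (partial_X (Hess Q)) x y \<noteq> 0 \<or> eval2 (partial_Y (Hess Q)) x y \<noteq> 0"
    if xy: "(x, y) \<in> real_curve (Hess Q)" for x y
  proof (rule ccontr)
    assume "\<not> ?thesis"
    then have "((\<lambda>z. eval2 (Hess Q) (fst z) (snd z)) has_derivative (\<lambda>_. 0)) (at (x, y))"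
      using has_derivative_eval2[of "Hess Q" "(x, y)"] by simp
    then have "(hess_patch k t has_derivative (\<lambda>_. 0)) (at (x, y))" unfolding ev .
    then show False using xy Zc(4) unfolding curve by blast
  qed
  then have "smooth_real_curve (Hess Q)"
    unfolding smooth_real_curve_def by blast
  moreover have "total_deg Q = d"
    unfolding Q_def k using t by (intro total_deg_patch_poly) simp
  ultimately show ?thesis using k by (intro exI[of _ Q]) simp
qed

end
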